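(* Consider AGLS-SIPP (described in the context) with parameter $\hat\rho>\bar\rho$, in which AGLS employs the early stop strategy, and suppose that $r$ and $f_\eta$ (for any $\eta>0$) are bounded below, that $l\in\mathbb{R}$ is a lower bound of $\phi_\eta$, and that $\mathcal{L}_\eta(x,y)=B(x,y)+\frac{L(x,y)}{\eta}$ with $B,L:\mathbb{R}^d\times\mathbb{R}^d\to[0,\infty)$ symmetric, nonnegative and continuous. Then the iterates of the inexact proximal point scheme satisfy $$x^k\ (0\le k\le K),\ \hat x^k\ (1\le k\le K)\ \in\ S_0:=\{x:\phi_\eta(x)\le\phi_\eta(x^0)\}.$$ Moreover, all the intermediate iterates produced by AGLS lie in $\mathcal{B}_{D^\dagger}(S_0):=\{x:\operatorname{dist}(x,S_0)\le D^\dagger\}$, where $D^\dagger=\sqrt{\frac{8}{\hat\rho-\bar\rho}[\phi(x^0)-l]}$. Besides, after $K$ outer iterations, the total number of iterations of AGLS is bounded by $$\left\lceil \log 4\cdot\sqrt{\frac{\tau_u\mathcal{L}^\dagger+\hat\rho-\bar\rho}{\hat\rho-\bar\rho}}\;K\right\rceil,\qquad \mathcal{L}^\dagger=\sup\{2\mathcal{L}_\eta(x,y)+2\bar\rho:\ x,y\in\mathcal{B}_{D^\dagger}(S_0)\}.$$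
   Context: Problem. $\phi=f+r$, $\phi_\eta=f_\eta+r$ on $\mathbb{R}^d$; $f:\mathbb{R}^d\to\mathbb{R}$ is weakly convex, $r:\mathbb{R}^d\to(-\infty,+\infty]$ is proper, convex, lower semicontinuous. $f_\eta$ is a smooth approximation of $f$ on $\mathbb{R}^d$: it is continuously differentiable, $\bar\rho$-weakly convex ($f_\eta+\frac{\bar\rho}2\|\cdot\|^2$ is convex, $\bar\rho>0$ independent of $\eta$), $f_\eta\le f\le f_\eta+\mathcal{R}_\eta$ for some $\mathcal{R}_\eta\ge0$, and $\|\nabla f_\eta(x)-\nabla f_\eta(y)\|\le\mathcal{L}_\eta(x,y)\|x-y\|$ for all $x,y$. AGLS-SIPP. From $x^0\in\operatorname{dom}r$, for $k=1,\dots,K$: let $\hat\phi_k(x)=\phi_\eta(x)+\frac{\hat\rho}{2}\|x-x^{k-1}\|^2$, $\hat x^k=\arg\min_x\hat\phi_k(x)$, and let $x^k$ be the output of AGLS applied from the initial point $x^{k-1}$ to $\hat\phi_k=g+\pi$ with $g(x)=f_\eta(x)+\frac{\bar\rho}2\|x-x^{k-1}\|^2$ (convex), $\pi(x)=r(x)+\frac{\hat\rho-\bar\rho}{2}\|x-x^{k-1}\|^2$ ($\mu$-strongly convex with $\mu=\hat\rho-\bar\rho$). AGLS for $\min g+\pi$ from a point $p$, with inputs $\mu>0$, $L_0\in(0,\infty)$, $\tau_d\in(0,1)$, $\tau_u\in(1,\infty)$ (its inner iterates are denoted $p^t,y^t,z^t$): set $p^0=y^0=z^0=p$, $\hat L_0=L_0$.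 For $t=1,2,\dots$: let $\bar L_t=\tau_d\hat L_{t-1}$ and let $k_t$ be the smallest nonnegative integer such that, with $\hat L_t=\bar L_t\tau_u^{k_t}$, $$p^t=(1-\alpha_t)y^{t-1}+\alpha_t((1-\beta_t)y^{t-1}+\beta_tz^{t-1}),$$ $$z^t=\arg\min_x\{\langle\nabla g(p^t),x\rangle+\pi(x)+\tfrac{\gamma_t}{2}\|x-z^{t-1}\|^2\},\qquad y^t=(1-\alpha_t)y^{t-1}+\alpha_tz^t,$$ satisfy $g(y^t)\le g(p^t)+\langle\nabla g(p^t),y^t-p^t\rangle+\frac{\hat L_t}{2}\|y^t-p^t\|^2$. The parameters are $\gamma_t=(\hat L_t+\mu)\alpha_t-\mu$, $\beta_t=\frac{\gamma_t}{\hat L_t\alpha_t}$, $\alpha_1=\sqrt{\mu/(\hat L_1+\mu)}$, and for $t\ge2$, $\alpha_t\in(0,1)$ solves $(\hat L_t+\mu)\alpha_t^2+(b_{t-1}-\mu)\alpha_t-b_{t-1}=0$ with $b_t=\alpha_t^2(\hat L_t+\mu)$. Early stop: as soon as $\prod_{i=1}^t\bigl(1-\sqrt{\mu/(\hat L_i+\mu)}\bigr)\le\frac14$, return $y^t$. "Intermediate iterates" are the accepted $p^t,y^t,z^t$; "iterations of AGLS" are counted by $t$.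
   Formalization: The bound on the total number of AGLS iterations is proved under the added condition 2·τ_d·L_0 ≤ τ_u·𝓛†; for arbitrary L_0 it fails, e.g. f=f_η=r=0, B=L=0, x^0=0, l=0, ρ̄=1, ρ̂=2, K=1, τ_u=2, τ_d=0.9, L_0=10^10. *)

theory Defs
  imports "HOL-Analysis.Analysis"
begin

section \<open>Problem class\<close>

text \<open>
  Extended-real-valued functions have type \<open>'a \<Rightarrow> ereal\<close>. Recall that
  \<open>0 * \<infinity> = 0\<close> in \<open>ereal\<close>, so the convexity inequality below is also correct
  for \<open>t \<in> {0, 1}\<close>; no value is \<open>-\<infinity>\<close> for a proper function, so the sum is never
  of the form \<open>\<infinity> - \<infinity>\<close>.
\<close>

definition proper_fun :: "('a \<Rightarrow> ereal) \<Rightarrow> bool" where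
  "proper_fun r \<longleftrightarrow> (\<forall>x. r x \<noteq> -\<infinity>) \<and> (\<exists>x. r x \<noteq> \<infinity>)"

definition edom :: "('a \<Rightarrow> ereal) \<Rightarrow> 'a set" where
  "edom r = {x. r x < \<infinity>}"

definition convex_efun :: "('a::real_vector \<Rightarrow> ereal) \<Rightarrow> bool" where
  "convex_efun r \<longleftrightarrow>
     (\<forall>x y t. 0 \<le> t \<and> t \<le> 1 \<longrightarrow>
        r ((1 - t) *\<^sub>R x + t *\<^sub>R y) \<le> ereal (1 - t) * r x + ereal t * r y)"

definition lsc_efun :: "('a::topological_space \<Rightarrow> ereal) \<Rightarrow> bool" where
  "lsc_efun r \<longleftrightarrow> (\<forall>x. r x \<le> Liminf (at x) r)"

definition weakly_convex :: "real \<Rightarrow> ('a::real_normed_vector \<Rightarrow> real) \<Rightarrow> bool" where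
  "weakly_convex \<rho> f \<longleftrightarrow> convex_on UNIV (\<lambda>x. f x + \<rho> / 2 * (norm x)\<^sup>2)"

text \<open>The gradient; meaningful only where the function is differentiable.\<close>

definition grad :: "('a::real_inner \<Rightarrow> real) \<Rightarrow> 'a \<Rightarrow> 'a" where
  "grad g x = (THE D. GDERIV g x :> D)"

definition cont_diff :: "('a::real_inner \<Rightarrow> real) \<Rightarrow> bool" where
  "cont_diff g \<longleftrightarrow> (\<forall>x. g differentiable (at x)) \<and> continuous_on UNIV (grad g)"

text \<open>
  \<open>fe \<eta>\<close> is the smooth approximation of \<open>f\<close> with parameter \<open>\<eta>\<close>, with gap \<open>\<R> \<eta>\<close> and
  point-dependent Lipschitz modulus \<open>\<L> \<eta> x y\<close> of the gradient.
\<close>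

definition smooth_approx ::
  "('a::real_inner \<Rightarrow> real) \<Rightarrow> (real \<Rightarrow> 'a \<Rightarrow> real) \<Rightarrow> real \<Rightarrow> (real \<Rightarrow> real) \<Rightarrow>
   (real \<Rightarrow> 'a \<Rightarrow> 'a \<Rightarrow> real) \<Rightarrow> bool" where
  "smooth_approx f fe \<rho> \<R> \<L> \<longleftrightarrow>
     (\<forall>\<eta>>0. cont_diff (fe \<eta>) \<and> weakly_convex \<rho> (fe \<eta>) \<and> 0 \<le> \<R> \<eta> \<and>
        (\<forall>x. fe \<eta> x \<le> f x \<and> f x \<le> fe \<eta> x + \<R> \<eta>) \<and>
        (\<forall>x y. norm (grad (fe \<eta>) x - grad (fe \<eta>) y) \<le> \<L> \<eta> x y * norm (x - y)))"

definition composite :: "('a \<Rightarrow> real) \<Rightarrow> ('a \<Rightarrow> ereal) \<Rightarrow> 'a \<Rightarrow> ereal" where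
  "composite f r x = ereal (f x) + r x"

definition sublevel :: "('a \<Rightarrow> ereal) \<Rightarrow> 'a \<Rightarrow> 'a set" where
  "sublevel \<phi> x0 = {x. \<phi> x \<le> \<phi> x0}"

definition enlarge :: "real \<Rightarrow> 'a::metric_space set \<Rightarrow> 'a set" where
  "enlarge D S = {x. infdist x S \<le> D}"

section \<open>AGLS\<close>

text \<open>
  The equation determining \<open>\<alpha>\<^sub>t\<close> from \<open>\<hat>L\<^sub>t = L\<close> and
  \<open>b\<^sub>t\<^sub>-\<^sub>1 = \<alpha>\<^sub>t\<^sub>-\<^sub>1\<^sup>2 (\<hat>L\<^sub>t\<^sub>-\<^sub>1 + \<mu>)\<close>; here \<open>a'\<close> and \<open>L'\<close> are the previous
  \<open>\<alpha>\<close> and \<open>\<hat>L\<close>.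
\<close>

definition agls_alpha :: "real \<Rightarrow> nat \<Rightarrow> real \<Rightarrow> real \<Rightarrow> real \<Rightarrow> real \<Rightarrow> bool" where
  "agls_alpha \<mu> t a' L' L a \<longleftrightarrow>
     (if t = 1 then a = sqrt (\<mu> / (L + \<mu>))
      else 0 < a \<and> a < 1 \<and>
        (let b = a'\<^sup>2 * (L' + \<mu>) in (L + \<mu>) * a\<^sup>2 + (b - \<mu>) * a - b = 0))"

text \<open>
  The candidate \<open>(a, p, z, y)\<close> generated in iteration \<open>t\<close> by the trial value \<open>L\<close>,
  from the previous quantities \<open>a', L', y', z'\<close>.
\<close>

definition agls_trial ::
  "('a::real_inner \<Rightarrow> real) \<Rightarrow> ('a \<Rightarrow> ereal) \<Rightarrow> real \<Rightarrow> nat \<Rightarrow> real \<Rightarrow> real \<Rightarrow> 'a \<Rightarrow> 'a \<Rightarrow>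
   real \<Rightarrow> real \<Rightarrow> 'a \<Rightarrow> 'a \<Rightarrow> 'a \<Rightarrow> bool" where
  "agls_trial g \<pi> \<mu> t a' L' y' z' L a p z y \<longleftrightarrow>
     agls_alpha \<mu> t a' L' L a \<and>
     (let \<gamma> = (L + \<mu>) * a - \<mu>; \<beta> = \<gamma> / (L * a) in
        p = (1 - a) *\<^sub>R y' + a *\<^sub>R ((1 - \<beta>) *\<^sub>R y' + \<beta> *\<^sub>R z') \<and>
        is_arg_min (\<lambda>x. ereal (grad g p \<bullet> x) + \<pi> x + ereal (\<gamma> / 2 * (norm (x - z'))\<^sup>2))
          (\<lambda>_. True) z \<and>
        y = (1 - a) *\<^sub>R y' + a *\<^sub>R z)"

definition agls_descent :: "('a::real_inner \<Rightarrow> real) \<Rightarrow> real \<Rightarrow> 'a \<Rightarrow> 'a \<Rightarrow> bool" where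
  "agls_descent g L p y \<longleftrightarrow>
     g y \<le> g p + grad g p \<bullet> (y - p) + L / 2 * (norm (y - p))\<^sup>2"

text \<open>
  Iteration \<open>t \<ge> 1\<close>: the accepted \<open>\<hat>L\<^sub>t\<close> is the first of the trial values
  \<open>\<tau>\<^sub>d \<hat>L\<^sub>t\<^sub>-\<^sub>1 \<tau>\<^sub>u\<^sup>j\<close>, \<open>j = 0, 1, \<dots>\<close>, whose candidate satisfies the descent test.
\<close>

definition agls_step ::
  "('a::real_inner \<Rightarrow> real) \<Rightarrow> ('a \<Rightarrow> ereal) \<Rightarrow> real \<Rightarrow> real \<Rightarrow> real \<Rightarrow>
   (nat \<Rightarrow> real) \<Rightarrow> (nat \<Rightarrow> real) \<Rightarrow> (nat \<Rightarrow> 'a) \<Rightarrow> (nat \<Rightarrow> 'a) \<Rightarrow> (nat \<Rightarrow> 'a) \<Rightarrow> nat \<Rightarrow> bool" where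
  "agls_step g \<pi> \<mu> \<tau>d \<tau>u \<alpha> Lh p y z t \<longleftrightarrow>
     (let trial = agls_trial g \<pi> \<mu> t (\<alpha> (t - 1)) (Lh (t - 1)) (y (t - 1)) (z (t - 1));
          Lbar = \<tau>d * Lh (t - 1)
      in \<exists>k. Lh t = Lbar * \<tau>u ^ k \<and>
           trial (Lh t) (\<alpha> t) (p t) (z t) (y t) \<and> agls_descent g (Lh t) (p t) (y t) \<and>
           (\<forall>j<k. \<not> (\<exists>a q w v. trial (Lbar * \<tau>u ^ j) a q w v \<and>
                              agls_descent g (Lbar * \<tau>u ^ j) q v)))"

text \<open>
  Early stop: the test is evaluated after each iteration, so iteration \<open>t\<close> is carried
  out iff the test has failed after all earlier iterations.
\<close>

definition agls_stop :: "real \<Rightarrow> (nat \<Rightarrow> real) \<Rightarrow> nat \<Rightarrow> bool" where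
  "agls_stop \<mu> Lh t \<longleftrightarrow> (\<Prod>i=1..t. 1 - sqrt (\<mu> / (Lh i + \<mu>))) \<le> 1 / 4"

definition agls_performed :: "real \<Rightarrow> (nat \<Rightarrow> real) \<Rightarrow> nat \<Rightarrow> bool" where
  "agls_performed \<mu> Lh t \<longleftrightarrow> 1 \<le> t \<and> (\<forall>i. 1 \<le> i \<and> i < t \<longrightarrow> \<not> agls_stop \<mu> Lh i)"

text \<open>
  A run of AGLS from \<open>start\<close> with output \<open>out\<close>. The sequences are constrained only at the
  iterations that are carried out. Termination is deliberately not assumed: \<open>out\<close> is
  \<open>y t\<close> for the iteration \<open>t\<close> at which the early stop occurs, if there is one.
\<close>

definition agls_run ::
  "('a::real_inner \<Rightarrow> real) \<Rightarrow> ('a \<Rightarrow> ereal) \<Rightarrow> real \<Rightarrow> real \<Rightarrow> real \<Rightarrow> real \<Rightarrow> 'a \<Rightarrow>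
   (nat \<Rightarrow> real) \<Rightarrow> (nat \<Rightarrow> real) \<Rightarrow> (nat \<Rightarrow> 'a) \<Rightarrow> (nat \<Rightarrow> 'a) \<Rightarrow> (nat \<Rightarrow> 'a) \<Rightarrow> 'a \<Rightarrow> bool" where
  "agls_run g \<pi> \<mu> L0 \<tau>d \<tau>u start \<alpha> Lh p y z out \<longleftrightarrow>
     p 0 = start \<and> y 0 = start \<and> z 0 = start \<and> Lh 0 = L0 \<and>
     (\<forall>t. agls_performed \<mu> Lh t \<longrightarrow> agls_step g \<pi> \<mu> \<tau>d \<tau>u \<alpha> Lh p y z t) \<and>
     (\<forall>t. agls_performed \<mu> Lh t \<and> agls_stop \<mu> Lh t \<longrightarrow> out = y t)"

section \<open>AGLS-SIPP\<close>

text \<open>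
  \<open>x k\<close> and \<open>xh k\<close> are the outer iterates and the exact proximal points; \<open>\<alpha> k\<close>, \<open>Lh k\<close>,
  \<open>p k\<close>, \<open>y k\<close>, \<open>z k\<close> are the sequences of the call of AGLS in outer iteration \<open>k\<close>.
  The argument \<open>fe\<close> is the smooth approximation for the chosen \<open>\<eta>\<close>.
\<close>

definition agls_sipp ::
  "('a::real_inner \<Rightarrow> real) \<Rightarrow> ('a \<Rightarrow> ereal) \<Rightarrow> real \<Rightarrow> real \<Rightarrow> real \<Rightarrow> real \<Rightarrow> real \<Rightarrow> nat \<Rightarrow> 'a \<Rightarrow>
   (nat \<Rightarrow> 'a) \<Rightarrow> (nat \<Rightarrow> 'a) \<Rightarrow> (nat \<Rightarrow> nat \<Rightarrow> real) \<Rightarrow> (nat \<Rightarrow> nat \<Rightarrow> real) \<Rightarrow>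
   (nat \<Rightarrow> nat \<Rightarrow> 'a) \<Rightarrow> (nat \<Rightarrow> nat \<Rightarrow> 'a) \<Rightarrow> (nat \<Rightarrow> nat \<Rightarrow> 'a) \<Rightarrow> bool" where
  "agls_sipp fe r \<rho>bar \<rho>hat L0 \<tau>d \<tau>u K x0 x xh \<alpha> Lh p y z \<longleftrightarrow>
     x0 \<in> edom r \<and> x 0 = x0 \<and>
     (\<forall>k\<in>{1..K}.
        is_arg_min (\<lambda>u. composite fe r u + ereal (\<rho>hat / 2 * (norm (u - x (k - 1)))\<^sup>2))
          (\<lambda>_. True) (xh k) \<and>
        agls_run
          (\<lambda>u. fe u + \<rho>bar / 2 * (norm (u - x (k - 1)))\<^sup>2)
          (\<lambda>u. r u + ereal ((\<rho>hat - \<rho>bar) / 2 * (norm (u - x (k - 1)))\<^sup>2))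
          (\<rho>hat - \<rho>bar) L0 \<tau>d \<tau>u (x (k - 1)) (\<alpha> k) (Lh k) (p k) (y k) (z k) (x k))"

text \<open>All AGLS iterations \<open>(k, t)\<close> carried out during the \<open>K\<close> outer iterations.\<close>

definition agls_iterations :: "real \<Rightarrow> nat \<Rightarrow> (nat \<Rightarrow> nat \<Rightarrow> real) \<Rightarrow> (nat \<times> nat) set" where
  "agls_iterations \<mu> K Lh = {(k, t). k \<in> {1..K} \<and> agls_performed \<mu> (Lh k) t}"

text \<open>The supremum is taken in \<open>ereal\<close>, as it may be infinite when \<open>S\<close> is unbounded.\<close>

definition L_dagger :: "('a \<Rightarrow> 'a \<Rightarrow> real) \<Rightarrow> real \<Rightarrow> 'a set \<Rightarrow> ereal" where
  "L_dagger \<L> \<rho>bar S = (SUP (x, y)\<in>S \<times> S. ereal (2 * \<L> x y + 2 * \<rho>bar))"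

end

theory Submission
  imports Defs
begin

text \<open>
  In one call of AGLS, \<open>b\<^sub>t = \<mu>\<close> for all \<open>t\<close>, so \<open>\<alpha>\<^sub>t = sqrt (\<mu> / (\<hat>L\<^sub>t + \<mu>))\<close>, and the energy
  \<open>\<Phi> y\<^sub>t - \<Phi> xh + \<mu>/2 \<parallel>xh - z\<^sub>t\<parallel>\<^sup>2\<close> contracts by the factor \<open>1 - \<alpha>\<^sub>t\<close>. By strong convexity of the
  proximal objective \<open>\<Phi>\<close>, its initial value is at most \<open>2 (\<Phi> c - \<Phi> xh)\<close>. Hence all iterates stay in
  a ball around \<open>xh\<close>, whose radius is at most \<open>D\<close>, and at the early stop \<open>\<Phi>\<close> is at most its initial value.
  A trial value rejected by the line search is at most the supremum of \<open>Lip + \<rho>\<close> on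
  this ball, hence at most half of \<open>Ld\<close>. The factor \<open>2\<close> gained here absorbs the rounding up of the number of
  iterations in each of the \<open>K\<close> calls.
\<close>

section \<open>Gradients and convexity\<close>

text \<open>Termination is nowhere assumed: a run is constrained only at the iterations carried out,
  so nothing is known about its output until finiteness has been proved. The modulus of the gradient
  is merely continuous and \<open>S0\<close> may be unbounded, so \<open>Ld\<close> may be infinite.
  What rescues termination is that each call stays in one compact ball, on which the modulus has
  some finite bound; \<open>Ld\<close> enters only in the count. The ball is centred at the proximal
  point rather than at the start, since the energy measures distances to it and it lies in
  \<open>S0\<close>. The supremum controls an accepted trial value only after a rejection. If
  nothing is ever rejected, the trial values are merely known to be at most
  \<open>\<tau>d * L0\<close>, which is why the count assumes
  \<open>2 * \<tau>d * L0 \<le> \<tau>u * real_of_ereal Ld\<close>.\<close>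

lemma GDERIV_grad:
  fixes g :: "'a::euclidean_space \<Rightarrow> real"
  assumes "g differentiable (at x)"
  shows "GDERIV g x :> grad g x"
proof -
  obtain g' where g': "(g has_derivative g') (at x)"
    using assms by (auto simp: differentiable_def)
  then have "linear g'" by (rule has_derivative_linear)
  then have "g' = (\<lambda>h. h \<bullet> adjoint g' 1)"
    by (simp add: adjoint_works)
  with g' have *: "GDERIV g x :> adjoint g' 1"
    by (simp add: gderiv_def)
  \<comment> \<open>\<open>grad\<close> is a definite description, so the representing vector must
    also be shown to be unique.\<close>
  have "D = adjoint g' 1" if "GDERIV g x :> D" for D
  proof -
    have "(\<lambda>h. h \<bullet> D) = (\<lambda>h. h \<bullet> adjoint g' 1)"
      using that * unfolding gderiv_def by (rule has_derivative_unique)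
    then show ?thesis by (metis vector_eq_ldot)
  qed
  with * show ?thesis
    unfolding grad_def by (rule theI)
qed

lemma grad_eqI:
  fixes g :: "'a::euclidean_space \<Rightarrow> real"
  assumes "GDERIV g x :> D"
  shows "grad g x = D"
proof -
  have "GDERIV g x :> grad g x"
    using assms by (intro GDERIV_grad) (auto simp: gderiv_def differentiable_def)
  then have "(\<lambda>h. h \<bullet> grad g x) = (\<lambda>h. h \<bullet> D)"
    using assms unfolding gderiv_def by (rule has_derivative_unique)
  then show ?thesis by (metis vector_eq_ldot)
qed

lemma GDERIV_half_norm_square:
  "GDERIV (\<lambda>u. m / 2 * (norm (u - c))\<^sup>2) x :> m *\<^sub>R (x - c)"
  unfolding gderiv_def power2_norm_eq_inner
  by (auto intro!: derivative_eq_intros simp: inner_commute algebra_simps)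

lemma DERIV_along_segment:
  fixes g :: "'a::real_inner \<Rightarrow> real"
  assumes "GDERIV g (a + t *\<^sub>R d) :> D"
  shows "((\<lambda>t. g (a + t *\<^sub>R d)) has_real_derivative d \<bullet> D) (at t)"
proof -
  have "((\<lambda>t. g (a + t *\<^sub>R d)) has_derivative (\<lambda>h. (h *\<^sub>R d) \<bullet> D)) (at t)"
    using assms unfolding gderiv_def
    by (rule has_derivative_compose[rotated]) (auto intro!: derivative_eq_intros)
  then show ?thesis
    by (simp add: has_field_derivative_def mult.commute[of _ "d \<bullet> D"])
qed

lemma convex_on_above_gradient:
  fixes g :: "'a::real_inner \<Rightarrow> real"
  assumes "convex_on UNIV g" and D: "GDERIV g p :> D"
  shows "g p + D \<bullet> (x - p) \<le> g x"
proof -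
  let ?h = "\<lambda>t. g (p + t *\<^sub>R (x - p))"
  have "(?h has_real_derivative (x - p) \<bullet> D) (at 0)"
    by (rule DERIV_along_segment) (use D in simp)
  then have "(?h has_real_derivative (x - p) \<bullet> D) (at_right 0)"
    by (rule has_field_derivative_at_within)
  then have lim: "((\<lambda>t. (?h t - ?h 0) / (t - 0)) \<longlongrightarrow> (x - p) \<bullet> D) (at_right 0)"
    by (simp only: has_field_derivative_iff)
  have "\<forall>\<^sub>F t in at_right 0. (?h t - ?h 0) / (t - 0) \<le> g x - g p"
    using eventually_at_right_real[OF zero_less_one]
  proof (eventually_elim)
    case (elim t)
    have "p + t *\<^sub>R (x - p) = (1 - t) *\<^sub>R p + t *\<^sub>R x"
      by (simp add: algebra_simps)
    then have "?h t \<le> (1 - t) * g p + t * g x"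
      using convex_onD[OF assms(1), of t p x] elim by simp
    then show ?case
      using elim by (simp add: field_simps)
  qed
  from tendsto_upperbound[OF lim this] show ?thesis
    by (simp add: inner_commute)
qed

text \<open>The modulus of the application depends on the points, so the Lipschitz bound is asked
  only between \<open>q\<close> and the points of the segment to \<open>v\<close>.\<close>

lemma descent_on_segment:
  fixes g :: "'a::real_inner \<Rightarrow> real"
  assumes D: "\<And>u. GDERIV g u :> G u"
    and M: "\<And>t. 0 \<le> t \<Longrightarrow> t \<le> 1 \<Longrightarrow>
      norm (G (q + t *\<^sub>R (v - q)) - G q) \<le> M * norm (t *\<^sub>R (v - q))"
  shows "g v \<le> g q + G q \<bullet> (v - q) + M / 2 * (norm (v - q))\<^sup>2"
proof -
  let ?d = "v - q"
  let ?h = "\<lambda>t. g (q + t *\<^sub>R ?d) - (t * (?d \<bullet> G q) + M / 2 * t\<^sup>2 * (norm ?d)\<^sup>2)"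
  have "?h 1 \<le> ?h 0"
  proof (rule DERIV_nonpos_imp_nonincreasing[of 0 1 ?h])
    fix t :: real assume t: "0 \<le> t" "t \<le> 1"
    let ?u = "q + t *\<^sub>R ?d"
    have "(?h has_real_derivative ?d \<bullet> G ?u - (?d \<bullet> G q + M * t * (norm ?d)\<^sup>2)) (at t)"
      by (rule derivative_eq_intros DERIV_along_segment D refl)+ simp
    moreover have "?d \<bullet> (G ?u - G q) \<le> norm ?d * (M * norm (t *\<^sub>R ?d))"
      by (rule order_trans[OF norm_cauchy_schwarz]) (intro mult_left_mono M t norm_ge_zero)
    then have "?d \<bullet> G ?u - ?d \<bullet> G q \<le> M * t * (norm ?d)\<^sup>2"
      using t by (simp add: inner_diff_right[of ?d] power2_eq_square mult.assoc mult.left_commute)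
    then have "?d \<bullet> G ?u - (?d \<bullet> G q + M * t * (norm ?d)\<^sup>2) \<le> 0"
      by simp
    ultimately show "\<exists>y. (?h has_real_derivative y) (at t) \<and> y \<le> 0" by blast
  qed simp
  then show ?thesis by (simp add: inner_commute algebra_simps)
qed

section \<open>Strong convexity relative to a set, with moduli that add up\<close>

definition strongly_convex_on :: "'a::real_inner set \<Rightarrow> real \<Rightarrow> ('a \<Rightarrow> real) \<Rightarrow> bool" where
  "strongly_convex_on S m h \<longleftrightarrow> convex S \<and>
     (\<forall>x\<in>S. \<forall>y\<in>S. \<forall>t\<in>{0..1}. h ((1 - t) *\<^sub>R x + t *\<^sub>R y)
        \<le> (1 - t) * h x + t * h y - m / 2 * t * (1 - t) * (norm (x - y))\<^sup>2)"

lemma strongly_convex_onD: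
  "\<lbrakk>strongly_convex_on S m h; x \<in> S; y \<in> S; 0 \<le> t; t \<le> 1\<rbrakk> \<Longrightarrow>
    h ((1 - t) *\<^sub>R x + t *\<^sub>R y)
      \<le> (1 - t) * h x + t * h y - m / 2 * t * (1 - t) * (norm (x - y))\<^sup>2"
  by (simp add: strongly_convex_on_def)

lemma strongly_convex_on_imp_convex: "strongly_convex_on S m h \<Longrightarrow> convex S"
  by (simp add: strongly_convex_on_def)

lemma strongly_convex_on_convex: "convex_on S h \<Longrightarrow> strongly_convex_on S 0 h"
  by (auto simp: strongly_convex_on_def convex_onD convex_on_imp_convex)

lemma strongly_convex_on_subset:
  "\<lbrakk>strongly_convex_on T m h; S \<subseteq> T; convex S\<rbrakk> \<Longrightarrow> strongly_convex_on S m h"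
  by (auto simp: strongly_convex_on_def)

lemma strongly_convex_on_add:
  assumes "strongly_convex_on S m f" "strongly_convex_on S n h"
  shows "strongly_convex_on S (m + n) (\<lambda>x. f x + h x)"
  unfolding strongly_convex_on_def
proof (intro conjI ballI)
  fix x y and t :: real
  assume "x \<in> S" "y \<in> S" "t \<in> {0..1}"
  then show "f ((1 - t) *\<^sub>R x + t *\<^sub>R y) + h ((1 - t) *\<^sub>R x + t *\<^sub>R y)
      \<le> (1 - t) * (f x + h x) + t * (f y + h y) - (m + n) / 2 * t * (1 - t) * (norm (x - y))\<^sup>2"
    using strongly_convex_onD[OF assms(1), of x y t] strongly_convex_onD[OF assms(2), of x y t]
    by (simp add: algebra_simps add_divide_distrib)
qed (rule strongly_convex_on_imp_convex[OF assms(1)])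

lemma strongly_convex_on_half_norm_square:
  assumes "convex S"
  shows "strongly_convex_on S m (\<lambda>x. m / 2 * (norm (x - c))\<^sup>2)"
  unfolding strongly_convex_on_def
proof (intro conjI ballI)
  fix x y and t :: real
  have "(1 - t) *\<^sub>R x + t *\<^sub>R y - c = (1 - t) *\<^sub>R (x - c) + t *\<^sub>R (y - c)"
    by (simp add: algebra_simps)
  moreover have "(norm ((1 - t) *\<^sub>R a + t *\<^sub>R b))\<^sup>2
      = (1 - t) * (norm a)\<^sup>2 + t * (norm b)\<^sup>2 - t * (1 - t) * (norm (a - b))\<^sup>2" for a b :: 'a
    unfolding power2_norm_eq_inner
    by (simp add: inner_add inner_diff inner_commute algebra_simps)
  ultimately have *: "(norm ((1 - t) *\<^sub>R x + t *\<^sub>R y - c))\<^sup>2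
      = (1 - t) * (norm (x - c))\<^sup>2 + t * (norm (y - c))\<^sup>2 - t * (1 - t) * (norm (x - y))\<^sup>2"
    by simp
  show "m / 2 * (norm ((1 - t) *\<^sub>R x + t *\<^sub>R y - c))\<^sup>2
      \<le> (1 - t) * (m / 2 * (norm (x - c))\<^sup>2) + t * (m / 2 * (norm (y - c))\<^sup>2)
        - m / 2 * t * (1 - t) * (norm (x - y))\<^sup>2"
    unfolding * by (simp add: field_simps)
qed (rule assms)

lemma strongly_convex_on_inner:
  "convex S \<Longrightarrow> strongly_convex_on S 0 (\<lambda>x. v \<bullet> x)"
  by (simp add: strongly_convex_on_def inner_add_right)

text \<open>The minimizer is compared with points of the segment close to it. Dividing by
  \<open>t\<close> before the limit keeps the full constant \<open>m / 2\<close>; comparing at the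
  midpoint would lose a factor.\<close>

lemma strongly_convex_on_min_growth:
  assumes h: "strongly_convex_on S m h" and "z \<in> S" "x \<in> S"
    and min: "\<And>u. u \<in> S \<Longrightarrow> h z \<le> h u"
  shows "h z + m / 2 * (norm (x - z))\<^sup>2 \<le> h x"
proof -
  have lim: "((\<lambda>t. m / 2 * (1 - t) * (norm (x - z))\<^sup>2) \<longlongrightarrow> m / 2 * (1 - 0) * (norm (x - z))\<^sup>2)
      (at_right (0::real))"
    by (intro tendsto_intros)
  have "\<forall>\<^sub>F t in at_right (0::real). m / 2 * (1 - t) * (norm (x - z))\<^sup>2 \<le> h x - h z"
    using eventually_at_right_real[OF zero_less_one]
  proof eventually_elim
    case (elim t)
    have "(1 - t) *\<^sub>R z + t *\<^sub>R x \<in> S"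
      using convexD[OF strongly_convex_on_imp_convex[OF h] assms(2,3), of "1 - t" t] elim by simp
    then have "h z \<le> (1 - t) * h z + t * h x - m / 2 * t * (1 - t) * (norm (z - x))\<^sup>2"
      using strongly_convex_onD[OF h assms(2,3), of t] min elim by fastforce
    then have "t * (m / 2 * (1 - t) * (norm (x - z))\<^sup>2) \<le> t * (h x - h z)"
      by (simp add: norm_minus_commute algebra_simps)
    then show ?case
      using elim by (simp only: mult_le_cancel_left_pos greaterThanLessThan_iff)
  qed
  from tendsto_upperbound[OF lim this] show ?thesis by simp
qed

section \<open>Lower semicontinuity and existence of proximal points\<close>

lemma lsc_efun_closed_epigraph:
  fixes r :: "'a::metric_space \<Rightarrow> ereal"
  assumes "lsc_efun r"
  shows "closed {(x, s). r x \<le> ereal s}"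
proof -
  have "\<exists>T. open T \<and> (x, s) \<in> T \<and> T \<subseteq> - {(x, s). r x \<le> ereal s}" if "\<not> r x \<le> ereal s" for x s
  proof -
    have "ereal s < r x" using that by simp
    then obtain a where a: "ereal s < a" "a < r x"
      using dense by blast
    \<comment> \<open>The filter \<open>at x\<close> omits \<open>x\<close> itself, so at
      \<open>x\<close> the bound has to come from \<open>a < r x\<close>.\<close>
    then have "eventually (\<lambda>u. a < r u) (at x)"
      using assms unfolding lsc_efun_def le_Liminf_iff by blast
    then obtain U where U: "open U" "x \<in> U" "\<forall>u\<in>U. u \<noteq> x \<longrightarrow> a < r u"
      unfolding eventually_at_topological by blast
    let ?T = "U \<times> {s'. ereal s' < a}"
    have "open {s'. ereal s' < a}"
      using open_vimage[OF open_lessThan[of a] continuous_on_ereal[OF continuous_on_id]]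
      by (simp add: vimage_def)
    then have "open ?T"
      using U by (intro open_Times)
    moreover have "(x, s) \<in> ?T" using U a by simp
    moreover have "?T \<subseteq> - {(x, s). r x \<le> ereal s}"
    proof clarsimp
      fix u s' assume "u \<in> U" "ereal s' < a" "r u \<le> ereal s'"
      then show False using U(3) a(2) by (metis leD less_le_trans less_trans)
    qed
    ultimately show ?thesis by blast
  qed
  then have "open (- {(x, s). r x \<le> ereal s})"
    by (subst open_subopen) auto
  then show ?thesis by (simp add: closed_def)
qed

text \<open>\<open>r\<close> need not be continuous, but on its epigraph the objective becomes a
  continuous function of the point and the height. The lower bound \<open>b\<close> confines both,
  so the relevant part of the epigraph is compact.\<close>

lemma prox_exists:
  fixes r :: "'a::euclidean_space \<Rightarrow> ereal"
  assumes "proper_fun r" "lsc_efun r" and bdd: "\<And>u. ereal b \<le> r u" and "0 < m"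
  shows "\<exists>z. \<forall>x. r z + ereal (m / 2 * (norm (z - w))\<^sup>2) \<le> r x + ereal (m / 2 * (norm (x - w))\<^sup>2)"
proof -
  let ?q = "\<lambda>x. m / 2 * (norm (x - w))\<^sup>2"
  obtain u where "r u \<noteq> \<infinity>" "r u \<noteq> -\<infinity>"
    using assms(1) by (auto simp: proper_fun_def)
  then obtain s where s: "r u = ereal s" by (cases "r u") auto
  let ?a = "s + ?q u"
  let ?K = "{(x, s). r x \<le> ereal s} \<inter> {(x, s). s + ?q x \<le> ?a}"
  have "closed {(x :: 'a, s). s + ?q x \<le> ?a}"
    unfolding case_prod_beta
    by (intro closed_Collect_le continuous_intros)
  then have cl: "closed ?K"
    using lsc_efun_closed_epigraph[OF assms(2)] by (rule closed_Int[rotated])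
  have "?K \<subseteq> cball w (sqrt (2 / m * (?a - b))) \<times> {b..?a}"
  proof
    fix xs assume "xs \<in> ?K"
    then obtain x s' where xs: "xs = (x, s')" and x: "r x \<le> ereal s'" "s' + ?q x \<le> ?a"
      by (cases xs) auto
    have b: "b \<le> s'" using bdd[of x] x(1) by (metis ereal_less_eq(3) order_trans)
    have "(norm (x - w))\<^sup>2 \<le> 2 / m * (?a - b)"
      using x b \<open>0 < m\<close> by (simp add: field_simps)
    then have "norm (x - w) \<le> sqrt (2 / m * (?a - b))"
      by (rule real_le_rsqrt)
    moreover have "0 \<le> ?q x" using \<open>0 < m\<close> by simp
    ultimately show "xs \<in> cball w (sqrt (2 / m * (?a - b))) \<times> {b..?a}"
      using b x(2) by (simp add: xs dist_norm norm_minus_commute)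
  qed
  then have "bounded ?K"
    by (rule bounded_subset[OF bounded_Times[OF bounded_cball bounded_closed_interval]])
  with cl have "compact ?K"
    by (simp only: compact_eq_bounded_closed)
  moreover have us: "(u, s) \<in> ?K" using s by simp
  moreover have "continuous_on ?K (\<lambda>(x, s). s + ?q x)"
    unfolding case_prod_beta by (intro continuous_intros)
  ultimately obtain zs where zs: "zs \<in> ?K"
    and zs_min: "\<forall>xs\<in>?K. (\<lambda>(x, s). s + ?q x) zs \<le> (\<lambda>(x, s). s + ?q x) xs"
    using continuous_attains_inf[of ?K "\<lambda>(x, s). s + ?q x"] by blast
  obtain z s0 where zs_eq: "zs = (z, s0)" by (cases zs)
  have z: "r z \<le> ereal s0" using zs by (simp add: zs_eq)
  have min: "s0 + ?q z \<le> s + ?q x" if "(x, s) \<in> ?K" for x s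
    using bspec[OF zs_min that] by (simp add: zs_eq)
  have "r z + ereal (?q z) \<le> r x + ereal (?q x)" for x
  proof (cases "r x")
    case (real sx)
    have "s0 + ?q z \<le> sx + ?q x"
    proof (cases "sx + ?q x \<le> ?a")
      case True
      then show ?thesis using real by (intro min) simp
    next
      case False
      then show ?thesis using min[OF us] by simp
    qed
    then have "ereal (s0 + ?q z) \<le> r x + ereal (?q x)" using real by simp
    moreover have "r z + ereal (?q z) \<le> ereal (s0 + ?q z)"
      using add_right_mono[OF z, of "ereal (?q z)"] by simp
    ultimately show ?thesis by (rule order_trans[rotated])
  next
    case MInf
    then show ?thesis using assms(1) by (simp add: proper_fun_def)
  qed simp
  then show ?thesis by blast
qed

section \<open>Counting the iterations of AGLS\<close>

text \<open>With \<open>s = 1 / v\<close> the left side is \<open>1 / (v - 1 / 2)\<close>, while the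
  common bound \<open>s \<le> - ln (1 - s)\<close> gives only \<open>1 / v\<close>. The half gained
  pays part of the rounding in the iteration count.\<close>

lemma two_div_two_minus_le_neg_ln:
  fixes s :: real
  assumes "0 \<le> s" "s < 1"
  shows "2 * s / (2 - s) \<le> - ln (1 - s)"
proof -
  let ?h = "\<lambda>t::real. - ln (1 - t) - 2 * t / (2 - t)"
  have "?h 0 \<le> ?h s"
  proof (rule DERIV_nonneg_imp_nondecreasing[of 0 s ?h])
    fix t assume t: "0 \<le> t" "t \<le> s"
    have "(?h has_real_derivative 1 / (1 - t) - (2 * (2 - t) + 2 * t) / (2 - t)\<^sup>2) (at t)"
      using t assms by (auto intro!: derivative_eq_intros simp: field_simps power2_eq_square)
    moreover have "4 * (1 - t) \<le> (2 - t)\<^sup>2"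
      by (simp add: power2_eq_square algebra_simps)
    then have "(2 * (2 - t) + 2 * t) / (2 - t)\<^sup>2 \<le> 1 / (1 - t)"
      using t assms by (simp add: pos_divide_le_eq pos_le_divide_eq)
    ultimately show "\<exists>y. (?h has_real_derivative y) (at t) \<and> 0 \<le> y"
      by (intro exI conjI) (assumption, simp)
  qed (use assms in simp)
  then show ?thesis by simp
qed

lemma agls_performed_Suc:
  "1 \<le> t \<Longrightarrow> agls_performed \<mu> Lh (Suc t) \<longleftrightarrow> agls_performed \<mu> Lh t \<and> \<not> agls_stop \<mu> Lh t"
  by (auto simp: agls_performed_def less_Suc_eq)

lemma agls_performed_1: "agls_performed \<mu> Lh 1"
  by (simp add: agls_performed_def)

text \<open>The last iteration carried out must have met the stopping test, since otherwise the next
  one would be carried out too.\<close>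

lemma agls_stop_exists:
  assumes "finite {t. agls_performed \<mu> Lh t}"
  obtains t where "agls_performed \<mu> Lh t" "agls_stop \<mu> Lh t"
proof -
  let ?T = "Max {t. agls_performed \<mu> Lh t}"
  have T: "agls_performed \<mu> Lh ?T"
    using Max_in[OF assms] agls_performed_1 by blast
  have "\<not> agls_performed \<mu> Lh (Suc ?T)"
    using Max_ge[OF assms, of "Suc ?T"] by auto
  moreover have "1 \<le> ?T" using T by (simp add: agls_performed_def)
  ultimately show thesis using T that agls_performed_Suc by blast
qed

text \<open>
  The number \<open>t\<close> of iterations is integral, which costs an additive constant against
  \<open>ln 4 / s\<close>. It is absorbed by the gap between \<open>v = sqrt (1 + X / (2 \<mu>))\<close>, which governs
  the decay of the products, and \<open>u = sqrt (1 + X / \<mu>)\<close>, once \<open>v \<ge> 4/3\<close>;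
  for \<open>v < 4/3\<close> one iteration suffices.
\<close>

lemma agls_iteration_count:
  fixes \<mu> X :: real
  assumes "0 < \<mu>" "0 < X"
    and Lh: "\<And>t. agls_performed \<mu> Lh t \<Longrightarrow> 0 < Lh t \<and> Lh t \<le> X / 2"
  shows "finite {t. agls_performed \<mu> Lh t}"
    and "real (card {t. agls_performed \<mu> Lh t}) \<le> ln 4 * sqrt ((X + \<mu>) / \<mu>)"
proof -
  define u where "u = sqrt ((X + \<mu>) / \<mu>)"
  define v where "v = sqrt ((X / 2 + \<mu>) / \<mu>)"
  define s where "s = 1 / v"
  have u2: "u\<^sup>2 = 1 + X / \<mu>" and v2: "v\<^sup>2 = 1 + X / \<mu> / 2"
    using assms by (simp_all add: u_def v_def field_simps)
  then have uv: "u\<^sup>2 = 2 * v\<^sup>2 - 1" by simp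
  have u1: "1 < u" and v1: "1 < v"
    using assms by (simp_all add: u_def v_def field_simps)
  have s: "0 < s" "s < 1" using v1 by (simp_all add: s_def)
  have ln4: "4 / 3 \<le> ln (4 :: real)"
    using ln2_ge_two_thirds ln_realpow[of 2 2] by simp
  have factor: "0 \<le> 1 - sqrt (\<mu> / (Lh i + \<mu>))" "1 - sqrt (\<mu> / (Lh i + \<mu>)) \<le> 1 - s"
    if "agls_performed \<mu> Lh i" for i
  proof -
    have "\<mu> / (X / 2 + \<mu>) \<le> \<mu> / (Lh i + \<mu>)"
      using Lh[OF that] assms by (intro divide_left_mono) auto
    then have "sqrt (\<mu> / (X / 2 + \<mu>)) \<le> sqrt (\<mu> / (Lh i + \<mu>))" by simp
    moreover have "s = sqrt (\<mu> / (X / 2 + \<mu>))"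
      by (simp add: s_def v_def real_sqrt_divide)
    ultimately show "1 - sqrt (\<mu> / (Lh i + \<mu>)) \<le> 1 - s" by simp
    show "0 \<le> 1 - sqrt (\<mu> / (Lh i + \<mu>))"
      using Lh[OF that] assms by simp
  qed
  have bound: "real t \<le> ln 4 * u" if t: "agls_performed \<mu> Lh t" for t
  proof (cases "t = 1")
    case True
    have "1 * 1 \<le> ln 4 * u" using ln4 u1 by (intro mult_mono) auto
    with True show ?thesis by simp
  next
    case False
    then obtain n where n: "t = Suc n" "1 \<le> n"
      using t by (cases t) (auto simp: agls_performed_def)
    have perf: "agls_performed \<mu> Lh i" if "i \<in> {1..n}" for i
      using t that n by (auto simp: agls_performed_def)
    \<comment> \<open>Iteration \<open>t\<close> is carried out because the test failed after
      \<open>n = t - 1\<close> iterations. Only \<open>n\<close> factors are controlled, and one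
      iteration must be paid for separately.\<close>
    have "1 / 4 < (\<Prod>i = 1..n. 1 - sqrt (\<mu> / (Lh i + \<mu>)))"
      using t n agls_performed_Suc[of n \<mu> Lh] by (simp add: agls_stop_def)
    also have "\<dots> \<le> (\<Prod>i = 1..n. 1 - s)"
      using factor perf by (intro prod_mono) auto
    finally have less: "1 / 4 < (1 - s) ^ n" by simp
    also have "(1 - s) ^ n \<le> (1 - s) ^ 1"
      using s n by (intro power_decreasing) auto
    finally have "s < 3 / 4" by simp
    then have v43: "4 / 3 < v"
      using v1 by (simp add: s_def field_simps)
    have "(v + 1 / 4)\<^sup>2 \<le> u\<^sup>2"
    proof -
      \<comment> \<open>The difference \<open>u\<^sup>2 - (v + 1 / 4)\<^sup>2\<close> equals
        \<open>v\<^sup>2 - v / 2 - 17 / 16\<close>, and this product is the smaller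
        \<open>v\<^sup>2 - v / 2 - 10 / 9\<close>.\<close>
      have "0 \<le> (v - 4 / 3) * (v + 5 / 6)" using v43 by simp
      then show ?thesis unfolding uv by (simp add: power2_eq_square algebra_simps)
    qed
    then have gap: "v + 1 / 4 \<le> u"
      by (rule power2_le_imp_le) (use u1 in simp)
    have "ln (1 / 4) < ln ((1 - s) ^ n)"
      by (rule ln_less_cancel_iff[THEN iffD2]) (use less s in simp_all)
    then have "- ln 4 < real n * ln (1 - s)"
      using s by (simp add: ln_realpow ln_div)
    moreover have "real n * (2 * s / (2 - s)) \<le> real n * (- ln (1 - s))"
      using two_div_two_minus_le_neg_ln[of s] s by (intro mult_left_mono) auto
    ultimately have "real n * (2 * s / (2 - s)) < ln 4" by simp
    moreover have "2 * s / (2 - s) = 1 / (v - 1 / 2)"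
      using v1 by (simp add: s_def field_simps)
    ultimately have "real n * (1 / (v - 1 / 2)) < ln 4" by (simp only:)
    then have "real n < ln 4 * (v - 1 / 2)"
      using v1 by (simp add: pos_divide_less_eq)
    \<comment> \<open>This pays for the extra iteration: of the factor \<open>3 / 4\<close>, the gap
      between \<open>u\<close> and \<open>v\<close> gives \<open>1 / 4\<close> and the sharpened
      logarithm bound gives \<open>1 / 2\<close>.\<close>
    moreover have "4 / 3 * (3 / 4) \<le> ln 4 * (u - v + 1 / 2)"
      using ln4 gap by (intro mult_mono) auto
    ultimately show ?thesis
      using n by (simp add: algebra_simps)
  qed
  define N where "N = nat \<lfloor>ln 4 * u\<rfloor>"
  have sub: "{t. agls_performed \<mu> Lh t} \<subseteq> {1..N}"
    using bound by (auto simp: N_def agls_performed_def le_nat_floor)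
  then show "finite {t. agls_performed \<mu> Lh t}"
    by (rule finite_subset) simp
  have "card {t. agls_performed \<mu> Lh t} \<le> N"
    using card_mono[OF _ sub] by simp
  moreover have "real N \<le> ln 4 * u"
    using u1 ln4 by (simp add: N_def)
  ultimately show "real (card {t. agls_performed \<mu> Lh t}) \<le> ln 4 * sqrt ((X + \<mu>) / \<mu>)"
    by (simp add: u_def)
qed

text \<open>With the previous step size of this form, \<open>b = \<mu>\<close>, so the linear term
  of the quadratic cancels. For \<open>t = 1\<close> nothing is known about
  \<open>\<alpha> 0\<close>, hence the disjunction.\<close>

lemma agls_alpha_iff:
  fixes \<mu> L L' :: real
  assumes "0 < \<mu>" "0 < L" "0 < L'" and a': "t = 1 \<or> a' = sqrt (\<mu> / (L' + \<mu>))"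
  shows "agls_alpha \<mu> t a' L' L a \<longleftrightarrow> a = sqrt (\<mu> / (L + \<mu>))"
proof (cases "t = 1")
  case False
  have b: "a'\<^sup>2 * (L' + \<mu>) = \<mu>"
    using assms False by simp
  have "0 < sqrt (\<mu> / (L + \<mu>))" "sqrt (\<mu> / (L + \<mu>)) < 1"
    using assms by simp_all
  moreover have "(L + \<mu>) * a\<^sup>2 + (\<mu> - \<mu>) * a - \<mu> = 0 \<longleftrightarrow> a = sqrt (\<mu> / (L + \<mu>))" if "0 < a"
  proof
    assume "(L + \<mu>) * a\<^sup>2 + (\<mu> - \<mu>) * a - \<mu> = 0"
    then have "a\<^sup>2 = \<mu> / (L + \<mu>)" using assms by (simp add: field_simps)
    then show "a = sqrt (\<mu> / (L + \<mu>))" using that by (metis less_imp_le real_sqrt_unique)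
  qed (use assms in simp)
  ultimately show ?thesis
    using False unfolding agls_alpha_def Let_def b by auto
qed (simp add: agls_alpha_def)

section \<open>One proximal subproblem\<close>

text \<open>Here \<open>\<rho>\<close> and \<open>\<mu>\<close> stand for \<open>\<rho>bar\<close>
  and \<open>\<rho>hat - \<rho>bar\<close>. The proximal term is split so that \<open>\<rho>\<close>
  makes the smooth part convex and \<open>\<mu>\<close> makes the nonsmooth part strongly
  convex.\<close>

locale agls_subproblem =
  fixes r :: "'a::euclidean_space \<Rightarrow> ereal" and F :: "'a \<Rightarrow> real" and Lip :: "'a \<Rightarrow> 'a \<Rightarrow> real"
    and \<rho> \<mu> b :: real and c xh :: 'a
  assumes r: "proper_fun r" "convex_efun r" "lsc_efun r" "\<And>u. ereal b \<le> r u"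
    and F: "cont_diff F" "weakly_convex \<rho> F"
    and Lip: "\<And>u w. norm (grad F u - grad F w) \<le> Lip u w * norm (u - w)"
    and Lip_continuous: "continuous_on UNIV (\<lambda>(u, w). Lip u w)"
    and pos: "0 < \<rho>" "0 < \<mu>"
    and c: "c \<in> edom r"
    and xh: "is_arg_min (\<lambda>u. composite F r u + ereal ((\<rho> + \<mu>) / 2 * (norm (u - c))\<^sup>2))
      (\<lambda>_. True) xh"
begin

definition g :: "'a \<Rightarrow> real" where
  "g = (\<lambda>u. F u + \<rho> / 2 * (norm (u - c))\<^sup>2)"

definition \<pi> :: "'a \<Rightarrow> ereal" where
  "\<pi> = (\<lambda>u. r u + ereal (\<mu> / 2 * (norm (u - c))\<^sup>2))"

text \<open>Off the domain \<open>real_of_ereal\<close> turns infinity into 0, so \<open>R\<close>,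
  \<open>P\<close> and \<open>\<Phi>\<close> carry meaning only on \<open>edom r\<close>;
  real-valued minimality is therefore stated over this set.\<close>

definition R :: "'a \<Rightarrow> real" where
  "R u = real_of_ereal (r u)"

definition P :: "'a \<Rightarrow> real" where
  "P u = R u + \<mu> / 2 * (norm (u - c))\<^sup>2"

definition \<Phi> :: "'a \<Rightarrow> real" where
  "\<Phi> u = g u + P u"

lemma r_eq: "u \<in> edom r \<Longrightarrow> r u = ereal (R u)"
  using r(1) by (cases "r u") (auto simp: R_def edom_def proper_fun_def)

lemma r_eq_infinity: "u \<notin> edom r \<Longrightarrow> r u = \<infinity>"
  by (cases "r u") (auto simp: edom_def)

lemma R_convex: "convex_on (edom r) R"
proof -
  have *: "(1 - t) *\<^sub>R x + t *\<^sub>R y \<in> edom r \<and>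
      R ((1 - t) *\<^sub>R x + t *\<^sub>R y) \<le> (1 - t) * R x + t * R y"
    if "x \<in> edom r" "y \<in> edom r" "0 \<le> t" "t \<le> 1" for x y t
  proof -
    let ?u = "(1 - t) *\<^sub>R x + t *\<^sub>R y"
    have "r ?u \<le> ereal (1 - t) * r x + ereal t * r y"
      using r(2) that unfolding convex_efun_def by blast
    then have le: "r ?u \<le> ereal ((1 - t) * R x + t * R y)"
      using that by (simp add: r_eq)
    then have u: "?u \<in> edom r"
      unfolding edom_def mem_Collect_eq by (rule le_less_trans) simp
    with le show ?thesis by (simp add: r_eq)
  qed
  then have "convex (edom r)"
    unfolding convex_alt by blast
  with * show ?thesis by (intro convex_onI) auto
qed

lemma P_strongly_convex: "strongly_convex_on (edom r) \<mu> P"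
  using strongly_convex_on_add[OF strongly_convex_on_convex[OF R_convex]
      strongly_convex_on_half_norm_square[OF convex_on_imp_convex[OF R_convex], of \<mu> c]]
  unfolding P_def by simp

lemma GDERIV_g: "GDERIV g u :> grad F u + \<rho> *\<^sub>R (u - c)"
  unfolding g_def using F(1)
  by (intro GDERIV_add GDERIV_half_norm_square GDERIV_grad) (simp add: cont_diff_def)

lemma grad_g: "grad g u = grad F u + \<rho> *\<^sub>R (u - c)"
  using GDERIV_g by (rule grad_eqI)

lemma GDERIV_grad_g: "GDERIV g u :> grad g u"
  unfolding grad_g by (rule GDERIV_g)

lemma grad_g_continuous: "continuous_on UNIV (grad g)"
  unfolding grad_g[abs_def] using F(1) by (intro continuous_intros) (simp add: cont_diff_def)

lemma g_continuous: "continuous_on UNIV g"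
  using GDERIV_grad_g unfolding gderiv_def
  by (intro has_derivative_continuous_on[of UNIV g "\<lambda>u h. h \<bullet> grad g u"]) simp

text \<open>Moving the centre of the quadratic from 0 to \<open>c\<close> changes it only by an
  affine function, so weak convexity applies for every centre.\<close>

lemma g_convex: "convex_on UNIV g"
proof -
  have affine: "convex_on UNIV (\<lambda>u. v \<bullet> u + k)" for v :: 'a and k :: real
    by (intro convex_onI) (simp_all add: inner_add_right algebra_simps)
  have "convex_on UNIV (\<lambda>u. (F u + \<rho> / 2 * (norm u)\<^sup>2) + ((- \<rho> *\<^sub>R c) \<bullet> u + \<rho> / 2 * (norm c)\<^sup>2))"
  proof (rule convex_on_add)
    show "convex_on UNIV (\<lambda>u. F u + \<rho> / 2 * (norm u)\<^sup>2)"
      using F(2) by (simp add: weakly_convex_def)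
    show "convex_on UNIV (\<lambda>u. (- \<rho> *\<^sub>R c) \<bullet> u + \<rho> / 2 * (norm c)\<^sup>2)"
      by (rule affine)
  qed
  moreover have "g = (\<lambda>u. (F u + \<rho> / 2 * (norm u)\<^sup>2) + ((- \<rho> *\<^sub>R c) \<bullet> u + \<rho> / 2 * (norm c)\<^sup>2))"
    unfolding g_def power2_norm_eq_inner
    by (simp add: fun_eq_iff inner_diff inner_commute field_simps)
  ultimately show ?thesis by simp
qed

lemma g_above_gradient: "g p + grad g p \<bullet> (u - p) \<le> g u"
  using g_convex GDERIV_grad_g by (rule convex_on_above_gradient)

lemma grad_g_diff_le: "norm (grad g u - grad g w) \<le> (Lip u w + \<rho>) * norm (u - w)"
proof -
  have "grad g u - grad g w = (grad F u - grad F w) + \<rho> *\<^sub>R (u - w)"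
    by (simp add: grad_g algebra_simps)
  then have "norm (grad g u - grad g w) \<le> norm (grad F u - grad F w) + norm (\<rho> *\<^sub>R (u - w))"
    by (simp only: norm_triangle_ineq)
  also have "\<dots> \<le> Lip u w * norm (u - w) + \<rho> * norm (u - w)"
    using Lip[of u w] pos by simp
  finally show ?thesis by (simp add: algebra_simps)
qed

lemma \<Phi>_strongly_convex: "strongly_convex_on (edom r) \<mu> \<Phi>"
proof -
  have "convex (edom r)" using R_convex by (rule convex_on_imp_convex)
  then have "strongly_convex_on (edom r) 0 g"
    using strongly_convex_on_convex[OF g_convex] by (rule strongly_convex_on_subset[rotated 2]) simp
  from strongly_convex_on_add[OF this P_strongly_convex]
  show ?thesis unfolding \<Phi>_def by simp
qed

lemma prox_objective:
  "u \<in> edom r \<Longrightarrow> composite F r u + ereal ((\<rho> + \<mu>) / 2 * (norm (u - c))\<^sup>2) = ereal (\<Phi> u)"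
  by (simp add: composite_def r_eq \<Phi>_def P_def g_def algebra_simps add_divide_distrib)

lemma xh_min:
  "composite F r xh + ereal ((\<rho> + \<mu>) / 2 * (norm (xh - c))\<^sup>2)
    \<le> composite F r u + ereal ((\<rho> + \<mu>) / 2 * (norm (u - c))\<^sup>2)"
  using xh by (simp add: is_arg_min_linorder)

lemma xh_in_edom: "xh \<in> edom r"
proof (rule ccontr)
  assume "xh \<notin> edom r"
  then show False
    using xh_min[of c] unfolding prox_objective[OF c] by (simp add: r_eq_infinity composite_def)
qed

lemma \<Phi>_xh_le:
  assumes "u \<in> edom r"
  shows "\<Phi> xh \<le> \<Phi> u"
  using xh_min[of u] unfolding prox_objective[OF xh_in_edom] prox_objective[OF assms] by simp

lemma \<Phi>_growth: "u \<in> edom r \<Longrightarrow> \<Phi> xh + \<mu> / 2 * (norm (u - xh))\<^sup>2 \<le> \<Phi> u"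
  using \<Phi>_strongly_convex xh_in_edom _ \<Phi>_xh_le by (rule strongly_convex_on_min_growth)

section \<open>The inner minimization step in real values\<close>

definition is_step :: "'a \<Rightarrow> real \<Rightarrow> 'a \<Rightarrow> 'a \<Rightarrow> bool" where
  "is_step v \<gamma> d z \<longleftrightarrow> z \<in> edom r \<and>
     (\<forall>x\<in>edom r. v \<bullet> z + P z + \<gamma> / 2 * (norm (z - d))\<^sup>2 \<le> v \<bullet> x + P x + \<gamma> / 2 * (norm (x - d))\<^sup>2)"

lemma is_step_iff:
  "is_step v \<gamma> d z \<longleftrightarrow>
     is_arg_min (\<lambda>x. ereal (v \<bullet> x) + \<pi> x + ereal (\<gamma> / 2 * (norm (x - d))\<^sup>2)) (\<lambda>_. True) z"
proof -
  let ?h = "\<lambda>x. ereal (v \<bullet> x) + \<pi> x + ereal (\<gamma> / 2 * (norm (x - d))\<^sup>2)"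
  have h: "?h x = ereal (v \<bullet> x + P x + \<gamma> / 2 * (norm (x - d))\<^sup>2)" if "x \<in> edom r" for x
    using that by (simp add: \<pi>_def P_def r_eq)
  have h_infinity: "?h x = \<infinity>" if "x \<notin> edom r" for x
    using that by (simp add: \<pi>_def r_eq_infinity)
  show ?thesis
  proof
    assume z: "is_step v \<gamma> d z"
    have "?h z \<le> ?h x" for x
    proof (cases "x \<in> edom r")
      case True
      with z have "?h z = ereal (v \<bullet> z + P z + \<gamma> / 2 * (norm (z - d))\<^sup>2)"
        by (intro h) (simp add: is_step_def)
      with z True show ?thesis by (simp only: h is_step_def) simp
    qed (simp add: \<pi>_def r_eq_infinity)
    then show "is_arg_min ?h (\<lambda>_. True) z" by (simp add: is_arg_min_linorder)
  next
    assume "is_arg_min ?h (\<lambda>_. True) z"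
    then have min: "?h z \<le> ?h x" for x by (simp add: is_arg_min_linorder)
    \<comment> \<open>The centre \<open>c\<close> gives a finite value, so a minimizer cannot lie
      off the domain.\<close>
    have z: "z \<in> edom r"
    proof (rule ccontr)
      assume "z \<notin> edom r"
      then show False
        using min[of c] unfolding h[OF c] by (simp add: \<pi>_def r_eq_infinity)
    qed
    moreover have "v \<bullet> z + P z + \<gamma> / 2 * (norm (z - d))\<^sup>2 \<le> v \<bullet> x + P x + \<gamma> / 2 * (norm (x - d))\<^sup>2"
      if "x \<in> edom r" for x
      using min[of x] by (simp only: h[OF z] h[OF that] ereal_less_eq)
    ultimately show "is_step v \<gamma> d z" by (simp add: is_step_def)
  qed
qed

lemma is_step_in_edom: "is_step v \<gamma> d z \<Longrightarrow> z \<in> edom r"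
  by (simp add: is_step_def)

lemma is_step_growth:
  assumes "is_step v \<gamma> d z" "x \<in> edom r"
  shows "v \<bullet> z + P z + \<gamma> / 2 * (norm (z - d))\<^sup>2 + (\<mu> + \<gamma>) / 2 * (norm (x - z))\<^sup>2
    \<le> v \<bullet> x + P x + \<gamma> / 2 * (norm (x - d))\<^sup>2"
proof (rule strongly_convex_on_min_growth)
  have "convex (edom r)" using R_convex by (rule convex_on_imp_convex)
  then show "strongly_convex_on (edom r) (\<mu> + \<gamma>)
      (\<lambda>x. v \<bullet> x + P x + \<gamma> / 2 * (norm (x - d))\<^sup>2)"
    using strongly_convex_on_add[OF strongly_convex_on_add[OF strongly_convex_on_inner
        P_strongly_convex] strongly_convex_on_half_norm_square]
    by simp
qed (use assms in \<open>simp_all add: is_step_def\<close>)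

text \<open>Completing the square merges the linear term and both quadratics into one proximal term
  of weight \<open>\<mu> + \<gamma>\<close> centred at \<open>w\<close>, up to the constant
  \<open>k\<close>.\<close>

lemma is_step_exists:
  assumes "0 \<le> \<gamma>"
  shows "\<exists>z. is_step v \<gamma> d z"
proof -
  define m where "m = \<mu> + \<gamma>"
  define w where "w = (1 / m) *\<^sub>R (\<mu> *\<^sub>R c + \<gamma> *\<^sub>R d - v)"
  have m: "0 < m" using assms pos by (simp add: m_def)
  obtain z where z: "\<And>x. r z + ereal (m / 2 * (norm (z - w))\<^sup>2) \<le> r x + ereal (m / 2 * (norm (x - w))\<^sup>2)"
    using prox_exists[OF r(1,3,4) m] by blast
  have zE: "z \<in> edom r"
  proof (rule ccontr)
    assume "z \<notin> edom r"
    then show False using z[of c] c by (simp add: r_eq_infinity r_eq)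
  qed
  define k where "k = \<mu> / 2 * (norm c)\<^sup>2 + \<gamma> / 2 * (norm d)\<^sup>2 - m / 2 * (norm w)\<^sup>2"
  have "m *\<^sub>R w = \<mu> *\<^sub>R c + \<gamma> *\<^sub>R d - v" using m by (simp add: w_def)
  then have "x \<bullet> (m *\<^sub>R w) = x \<bullet> (\<mu> *\<^sub>R c + \<gamma> *\<^sub>R d - v)" for x by simp
  then have w: "m * (x \<bullet> w) = \<mu> * (x \<bullet> c) + \<gamma> * (x \<bullet> d) - v \<bullet> x" for x
    by (simp only: inner_add_right inner_diff_right inner_scaleR_right inner_commute[of v x])
  have "v \<bullet> x + P x + \<gamma> / 2 * (norm (x - d))\<^sup>2 = R x + m / 2 * (norm (x - w))\<^sup>2 + k" for x
  proof -
    have "m / 2 * (norm (x - w))\<^sup>2 = m / 2 * (norm x)\<^sup>2 - m * (x \<bullet> w) + m / 2 * (norm w)\<^sup>2"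
      unfolding power2_norm_eq_inner by (simp add: inner_diff inner_commute field_simps)
    also have "\<dots> = m / 2 * (norm x)\<^sup>2 - (\<mu> * (x \<bullet> c) + \<gamma> * (x \<bullet> d) - v \<bullet> x) + m / 2 * (norm w)\<^sup>2"
      by (simp only: w)
    finally show ?thesis
      unfolding P_def k_def m_def power2_norm_eq_inner
      by (simp add: inner_diff inner_commute field_simps)
  qed
  moreover have "R z + m / 2 * (norm (z - w))\<^sup>2 \<le> R x + m / 2 * (norm (x - w))\<^sup>2" if "x \<in> edom r" for x
    using z[of x] that zE by (simp add: r_eq)
  ultimately have "is_step v \<gamma> d z"
    using zE by (simp add: is_step_def)
  then show ?thesis ..
qed

text \<open>Each minimizer is tested against the other in the growth inequality; in the sum,
  \<open>P\<close> cancels. Equal data give uniqueness of the step, varying data its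
  continuity.\<close>

lemma is_step_dist:
  assumes "is_step v1 \<gamma>1 d z1" "is_step v2 \<gamma>2 d z2" "0 \<le> \<gamma>1"
  shows "\<mu> * norm (z1 - z2) \<le> norm (v1 - v2) + \<bar>\<gamma>1 - \<gamma>2\<bar> * norm (z2 - d)"
proof (cases "z1 = z2")
  case False
  define n where "n = norm (z1 - z2)"
  have n: "0 < n" using False by (simp add: n_def)
  \<comment> \<open>Expanding around \<open>z2\<close> leaves \<open>n\<^sup>2\<close> with the
    coefficient \<open>\<mu> + \<gamma>1\<close>, free of \<open>\<gamma>2\<close>, and pairs
    \<open>\<gamma>1 - \<gamma>2\<close> with the distance of \<open>z2\<close> from
    \<open>d\<close>.\<close>
  have exp: "(norm (z1 - d))\<^sup>2 = (norm (z2 - d))\<^sup>2 + n\<^sup>2 + 2 * ((z1 - z2) \<bullet> (z2 - d))"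
    unfolding n_def power2_norm_eq_inner by (simp add: inner_diff inner_commute)
  have "v1 \<bullet> z1 + P z1 + \<gamma>1 / 2 * (norm (z1 - d))\<^sup>2 + (\<mu> + \<gamma>1) / 2 * n\<^sup>2
      \<le> v1 \<bullet> z2 + P z2 + \<gamma>1 / 2 * (norm (z2 - d))\<^sup>2"
    using is_step_growth[OF assms(1) is_step_in_edom[OF assms(2)]]
    by (simp add: n_def norm_minus_commute)
  moreover have "v2 \<bullet> z2 + P z2 + \<gamma>2 / 2 * (norm (z2 - d))\<^sup>2 + (\<mu> + \<gamma>2) / 2 * n\<^sup>2
      \<le> v2 \<bullet> z1 + P z1 + \<gamma>2 / 2 * (norm (z1 - d))\<^sup>2"
    using is_step_growth[OF assms(2) is_step_in_edom[OF assms(1)]] by (simp add: n_def)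
  ultimately have "(\<mu> + \<gamma>1) * n\<^sup>2
      \<le> (v1 - v2) \<bullet> (z2 - z1) + (\<gamma>2 - \<gamma>1) * ((z1 - z2) \<bullet> (z2 - d))"
    unfolding exp by (simp add: inner_diff_left inner_diff_right field_simps)
  also have "\<dots> \<le> norm (v1 - v2) * n + \<bar>\<gamma>1 - \<gamma>2\<bar> * (n * norm (z2 - d))"
  proof (rule add_mono)
    show "(v1 - v2) \<bullet> (z2 - z1) \<le> norm (v1 - v2) * n"
      using norm_cauchy_schwarz[of "v1 - v2" "z2 - z1"] by (simp add: n_def norm_minus_commute)
    have "(\<gamma>2 - \<gamma>1) * ((z1 - z2) \<bullet> (z2 - d)) \<le> \<bar>\<gamma>2 - \<gamma>1\<bar> * \<bar>(z1 - z2) \<bullet> (z2 - d)\<bar>"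
      by (simp only: abs_mult[symmetric] abs_ge_self)
    also have "\<dots> \<le> \<bar>\<gamma>2 - \<gamma>1\<bar> * (n * norm (z2 - d))"
      unfolding n_def by (intro mult_left_mono Cauchy_Schwarz_ineq2) simp
    finally show "(\<gamma>2 - \<gamma>1) * ((z1 - z2) \<bullet> (z2 - d)) \<le> \<bar>\<gamma>1 - \<gamma>2\<bar> * (n * norm (z2 - d))"
      by (simp add: abs_minus_commute)
  qed
  finally have "n * ((\<mu> + \<gamma>1) * n) \<le> n * (norm (v1 - v2) + \<bar>\<gamma>1 - \<gamma>2\<bar> * norm (z2 - d))"
    by (simp add: power2_eq_square algebra_simps)
  then have "(\<mu> + \<gamma>1) * n \<le> norm (v1 - v2) + \<bar>\<gamma>1 - \<gamma>2\<bar> * norm (z2 - d)"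
    using n by simp
  moreover have "0 \<le> \<gamma>1 * n" using assms n by simp
  ultimately show ?thesis
    unfolding n_def[symmetric] by (simp add: distrib_right)
qed simp

subsection \<open>The accelerated step\<close>

definition stepsize :: "real \<Rightarrow> real" where
  "stepsize L = sqrt (\<mu> / (L + \<mu>))"

definition gam :: "real \<Rightarrow> real" where
  "gam L = (L + \<mu>) * stepsize L - \<mu>"

definition query :: "'a \<Rightarrow> 'a \<Rightarrow> real \<Rightarrow> 'a" where
  "query y z L = (1 - stepsize L) *\<^sub>R y + stepsize L *\<^sub>R
    ((1 - gam L / (L * stepsize L)) *\<^sub>R y + (gam L / (L * stepsize L)) *\<^sub>R z)"

definition next_z :: "'a \<Rightarrow> 'a \<Rightarrow> real \<Rightarrow> 'a" where
  "next_z y z L = (SOME u. is_step (grad g (query y z L)) (gam L) z u)"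

definition next_y :: "'a \<Rightarrow> 'a \<Rightarrow> real \<Rightarrow> 'a" where
  "next_y y z L = (1 - stepsize L) *\<^sub>R y + stepsize L *\<^sub>R next_z y z L"

lemma stepsize_bounds: "0 < L \<Longrightarrow> 0 < stepsize L" "0 < L \<Longrightarrow> stepsize L < 1"
  using pos by (simp_all add: stepsize_def)

lemma stepsize_square: "0 < L \<Longrightarrow> (L + \<mu>) * (stepsize L)\<^sup>2 = \<mu>"
  using pos by (simp add: stepsize_def)

lemma stepsize_gam: "0 < L \<Longrightarrow> stepsize L * gam L = \<mu> * (1 - stepsize L)"
  using stepsize_square[of L] by (simp add: gam_def power2_eq_square algebra_simps)

lemma gam_pos:
  assumes "0 < L"
  shows "0 < gam L"
proof -
  have "0 < stepsize L * gam L"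
    unfolding stepsize_gam[OF assms] using stepsize_bounds[OF assms] pos by simp
  then show ?thesis
    using stepsize_bounds[OF assms] by (simp add: zero_less_mult_iff)
qed

text \<open>Makes the query point a convex combination of \<open>y\<close> and \<open>z\<close>, so
  that every ball containing both contains it.\<close>

lemma gam_ratio_bounds:
  assumes "0 < L"
  shows "0 \<le> gam L / (L * stepsize L)" "gam L / (L * stepsize L) \<le> 1"
proof -
  have "gam L - L * stepsize L = \<mu> * (stepsize L - 1)"
    by (simp add: gam_def algebra_simps)
  also have "\<dots> \<le> 0"
    using stepsize_bounds[OF assms] pos by (simp add: mult_nonneg_nonpos)
  finally show "gam L / (L * stepsize L) \<le> 1"
    using assms stepsize_bounds[OF assms] by simp
  show "0 \<le> gam L / (L * stepsize L)"
    using assms stepsize_bounds[OF assms] gam_pos[OF assms] by simp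
qed

lemma is_step_unique:
  assumes "is_step v \<gamma> d z1" "is_step v \<gamma> d z2" "0 \<le> \<gamma>"
  shows "z1 = z2"
proof -
  have "\<mu> * norm (z1 - z2) \<le> 0"
    using is_step_dist[OF assms] by simp
  then have "norm (z1 - z2) \<le> 0"
    using pos by (simp only: mult_le_0_iff) auto
  then show ?thesis by simp
qed

lemma next_z_step: "0 < L \<Longrightarrow> is_step (grad g (query y z L)) (gam L) z (next_z y z L)"
  unfolding next_z_def by (rule someI_ex, rule is_step_exists, rule less_imp_le, rule gam_pos)

text \<open>The trial relation is the graph of a function of \<open>L\<close>. A rejected trial,
  given as the failure of all its candidates, thus becomes a statement about one explicit
  candidate.\<close>

lemma agls_trial_iff:
  assumes "0 < L" "0 < L'" "t = 1 \<or> a' = stepsize L'"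
  shows "agls_trial g \<pi> \<mu> t a' L' y' z' L a p z y \<longleftrightarrow>
    a = stepsize L \<and> p = query y' z' L \<and> z = next_z y' z' L \<and> y = next_y y' z' L"
proof -
  have alpha: "agls_alpha \<mu> t a' L' L a \<longleftrightarrow> a = stepsize L"
    unfolding stepsize_def using assms pos
    by (intro agls_alpha_iff) (simp_all add: stepsize_def)
  have "is_step (grad g (query y' z' L)) (gam L) z' z \<longleftrightarrow> z = next_z y' z' L"
    using is_step_unique next_z_step[OF assms(1)] gam_pos[OF assms(1)]
    by (metis less_imp_le)
  then show ?thesis
    unfolding agls_trial_def alpha Let_def is_step_iff[symmetric]
    by (auto simp: gam_def query_def next_y_def)
qed

section \<open>Continuity of the candidates in the trial value\<close>

lemma stepsize_continuous: "continuous_on {0<..} stepsize"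
  unfolding stepsize_def using pos by (intro continuous_intros) auto

lemma gam_continuous: "continuous_on {0<..} gam"
  unfolding gam_def by (intro continuous_intros stepsize_continuous)

lemma query_continuous: "continuous_on {0<..} (query y z)"
proof -
  have "L * stepsize L \<noteq> 0" if "L \<in> {0<..}" for L
    using stepsize_bounds(1)[of L] that by simp
  then show ?thesis
    unfolding query_def
    by (intro continuous_intros stepsize_continuous gam_continuous ballI)
qed

lemma next_z_continuous: "continuous_on {0<..} (next_z y z)"
  unfolding continuous_on_def
proof
  fix L assume L: "L \<in> {0::real<..}"
  let ?v = "\<lambda>L. grad g (query y z L)"
  let ?e = "\<lambda>L'. (norm (?v L' - ?v L) + \<bar>gam L' - gam L\<bar> * norm (next_z y z L - z)) / \<mu>"
  have "continuous_on {0<..} ?v"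
    using continuous_on_compose2[OF grad_g_continuous query_continuous] by simp
  then have "(?v \<longlongrightarrow> ?v L) (at L within {0<..})"
    using L by (simp add: continuous_on_def)
  moreover have "(gam \<longlongrightarrow> gam L) (at L within {0<..})"
    using L gam_continuous by (simp add: continuous_on_def)
  ultimately have "(?e \<longlongrightarrow> (norm (?v L - ?v L) + \<bar>gam L - gam L\<bar> * norm (next_z y z L - z)) / \<mu>)
      (at L within {0<..})"
    using pos by (intro tendsto_intros) simp_all
  then have lim: "(?e \<longlongrightarrow> 0) (at L within {0<..})" by simp
  have bound: "norm (next_z y z L' - next_z y z L) \<le> ?e L'" if "L' \<in> {0<..}" for L'
    using is_step_dist[OF next_z_step next_z_step less_imp_le[OF gam_pos]] that L pos
    by (simp add: pos_le_divide_eq mult.commute)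
  have "\<forall>\<^sub>F L' in at L within {0<..}. norm (next_z y z L' - next_z y z L) \<le> ?e L'"
    unfolding eventually_at_filter by (rule always_eventually) (use bound in blast)
  then have "((\<lambda>L'. next_z y z L' - next_z y z L) \<longlongrightarrow> 0) (at L within {0<..})"
    using lim by (rule Lim_null_comparison)
  then show "(next_z y z \<longlongrightarrow> next_z y z L) (at L within {0<..})"
    by (simp only: LIM_zero_iff)
qed

lemma next_y_continuous: "continuous_on {0<..} (next_y y z)"
  unfolding next_y_def by (intro continuous_intros stepsize_continuous next_z_continuous)

section \<open>Decay of the energy\<close>

definition energy :: "'a \<Rightarrow> 'a \<Rightarrow> real" where
  "energy y z = \<Phi> y - \<Phi> xh + \<mu> / 2 * (norm (xh - z))\<^sup>2"

lemma next_in_edom: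
  assumes "0 < L" "y \<in> edom r"
  shows "next_z y z L \<in> edom r" "next_y y z L \<in> edom r"
proof -
  show *: "next_z y z L \<in> edom r"
    using next_z_step[OF assms(1)] by (rule is_step_in_edom)
  show "next_y y z L \<in> edom r"
    unfolding next_y_def
    using convexD[OF convex_on_imp_convex[OF R_convex] assms(2) *] stepsize_bounds[OF assms(1)]
    by simp
qed

text \<open>The quadratic error in the descent test is paid from two sources: strong convexity of
  \<open>P\<close> between \<open>y\<close> and the new \<open>z\<close>, and the proximal term of
  the inner step. The weight \<open>\<beta>\<close> in the query point splits the error in exactly
  the proportion in which these are available.\<close>

lemma energy_step:
  assumes L: "0 < L" and y: "y \<in> edom r"
    and descent: "agls_descent g L (query y z L) (next_y y z L)"
  shows "energy (next_y y z L) (next_z y z L) \<le> (1 - stepsize L) * energy y z"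
proof -
  define a where "a = stepsize L"
  define \<gamma> where "\<gamma> = gam L"
  define \<beta> where "\<beta> = gam L / (L * stepsize L)"
  define p where "p = query y z L"
  define y' where "y' = next_y y z L"
  define z' where "z' = next_z y z L"
  define G where "G = grad g p"
  have a: "0 < a" "a < 1" using stepsize_bounds[OF L] by (simp_all add: a_def)
  have a2: "(L + \<mu>) * a\<^sup>2 = \<mu>" and a\<gamma>: "a * \<gamma> = \<mu> * (1 - a)"
    using stepsize_square[OF L] stepsize_gam[OF L] by (simp_all add: a_def \<gamma>_def)
  have \<beta>: "0 \<le> \<beta>" "\<beta> \<le> 1" using gam_ratio_bounds[OF L] by (simp_all add: \<beta>_def)
  have La\<beta>: "L * a * \<beta> = \<gamma>" using L a by (simp add: \<beta>_def \<gamma>_def a_def)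
  have z': "z' \<in> edom r" using next_in_edom(1)[OF L y] by (simp add: z'_def)
  have y'_eq: "y' = (1 - a) *\<^sub>R y + a *\<^sub>R z'"
    by (simp add: y'_def z'_def next_y_def a_def)
  have p_eq: "p = (1 - a) *\<^sub>R y + a *\<^sub>R ((1 - \<beta>) *\<^sub>R y + \<beta> *\<^sub>R z)"
    by (simp add: p_def query_def a_def \<beta>_def)
  have "g y' \<le> g p + G \<bullet> (y' - p) + L / 2 * (norm (y' - p))\<^sup>2"
    using descent by (simp add: agls_descent_def p_def y'_def G_def)
  also have "g p + G \<bullet> (y' - p) = (1 - a) * (g p + G \<bullet> (y - p)) + a * (g p + G \<bullet> (z' - p))"
    by (simp add: y'_eq inner_diff_right inner_add_right algebra_simps)
  also have "\<dots> \<le> (1 - a) * g y + a * (g p + G \<bullet> (z' - p))"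
    using g_above_gradient[of p y] a by (intro add_mono mult_left_mono) (simp_all add: G_def)
  finally have A: "g y' \<le> (1 - a) * g y + a * (g p + G \<bullet> (z' - p)) + L / 2 * (norm (y' - p))\<^sup>2"
    by simp
  have B: "P y' \<le> (1 - a) * P y + a * P z' - \<mu> / 2 * a * (1 - a) * (norm (z' - y))\<^sup>2"
    using strongly_convex_onD[OF P_strongly_convex y z', of a] a
    by (simp add: y'_eq norm_minus_commute)
  have "G \<bullet> z' + P z' + \<gamma> / 2 * (norm (z' - z))\<^sup>2 + (\<mu> + \<gamma>) / 2 * (norm (xh - z'))\<^sup>2
      \<le> G \<bullet> xh + P xh + \<gamma> / 2 * (norm (xh - z))\<^sup>2"
    using is_step_growth[OF next_z_step[OF L] xh_in_edom] by (simp add: G_def p_def z'_def \<gamma>_def)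
  moreover have "g p + G \<bullet> (xh - p) \<le> g xh"
    unfolding G_def by (rule g_above_gradient)
  ultimately have "g p + G \<bullet> (z' - p) + P z' + \<gamma> / 2 * (norm (z' - z))\<^sup>2
      + (\<mu> + \<gamma>) / 2 * (norm (xh - z'))\<^sup>2 \<le> \<Phi> xh + \<gamma> / 2 * (norm (xh - z))\<^sup>2"
    by (simp add: \<Phi>_def inner_diff_right)
  then have "a * (g p + G \<bullet> (z' - p) + P z' + \<gamma> / 2 * (norm (z' - z))\<^sup>2
      + (\<mu> + \<gamma>) / 2 * (norm (xh - z'))\<^sup>2) \<le> a * (\<Phi> xh + \<gamma> / 2 * (norm (xh - z))\<^sup>2)"
    using a by (intro mult_left_mono) auto
  then have "a * (g p + G \<bullet> (z' - p)) + a * P z' + (a * \<gamma>) / 2 * (norm (z' - z))\<^sup>2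
      + (a * \<mu> + a * \<gamma>) / 2 * (norm (xh - z'))\<^sup>2
      \<le> a * \<Phi> xh + (a * \<gamma>) / 2 * (norm (xh - z))\<^sup>2"
    by (simp add: field_simps)
  \<comment> \<open>This identity gives the new distance to \<open>xh\<close> the full weight
    \<open>\<mu> / 2\<close>, while the old one keeps only the fraction
    \<open>1 - a\<close>.\<close>
  moreover have "a * \<mu> + a * \<gamma> = \<mu>" unfolding a\<gamma> by (simp add: algebra_simps)
  ultimately have C: "a * (g p + G \<bullet> (z' - p)) + a * P z' + \<mu> * (1 - a) / 2 * (norm (z' - z))\<^sup>2
      + \<mu> / 2 * (norm (xh - z'))\<^sup>2 \<le> a * \<Phi> xh + \<mu> * (1 - a) / 2 * (norm (xh - z))\<^sup>2"
    by (simp only: a\<gamma>)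
  \<comment> \<open>The displacement is \<open>a\<close> times a convex combination of
    \<open>z' - y\<close> and \<open>z' - z\<close>, the two vectors whose squares appear in
    \<open>B\<close> and \<open>C\<close>.\<close>
  have "y' - p = a *\<^sub>R ((1 - \<beta>) *\<^sub>R (z' - y) + \<beta> *\<^sub>R (z' - z))"
    by (simp add: y'_eq p_eq algebra_simps)
  then have "(norm (y' - p))\<^sup>2 = a\<^sup>2 * (norm ((1 - \<beta>) *\<^sub>R (z' - y) + \<beta> *\<^sub>R (z' - z)))\<^sup>2"
    by (simp add: power_mult_distrib)
  also have "\<dots> \<le> a\<^sup>2 * ((1 - \<beta>) * (norm (z' - y))\<^sup>2 + \<beta> * (norm (z' - z))\<^sup>2)"
  proof (rule mult_left_mono)
    have "strongly_convex_on UNIV 2 (\<lambda>x :: 'a. (norm x)\<^sup>2)"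
      using strongly_convex_on_half_norm_square[OF convex_UNIV, of 2 0] by simp
    from strongly_convex_onD[OF this, of "z' - y" "z' - z" \<beta>]
    have "(norm ((1 - \<beta>) *\<^sub>R (z' - y) + \<beta> *\<^sub>R (z' - z)))\<^sup>2
      \<le> (1 - \<beta>) * (norm (z' - y))\<^sup>2 + \<beta> * (norm (z' - z))\<^sup>2
        - \<beta> * (1 - \<beta>) * (norm ((z' - y) - (z' - z)))\<^sup>2"
      using \<beta> by simp
    moreover have "0 \<le> \<beta> * (1 - \<beta>) * (norm ((z' - y) - (z' - z)))\<^sup>2" using \<beta> by simp
    ultimately show "(norm ((1 - \<beta>) *\<^sub>R (z' - y) + \<beta> *\<^sub>R (z' - z)))\<^sup>2
      \<le> (1 - \<beta>) * (norm (z' - y))\<^sup>2 + \<beta> * (norm (z' - z))\<^sup>2" by linarith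
  qed simp
  finally have "L / 2 * (norm (y' - p))\<^sup>2
      \<le> L / 2 * (a\<^sup>2 * ((1 - \<beta>) * (norm (z' - y))\<^sup>2 + \<beta> * (norm (z' - z))\<^sup>2))"
    using L by (intro mult_left_mono) auto
  also have "\<dots> = (L * a\<^sup>2 * (1 - \<beta>)) / 2 * (norm (z' - y))\<^sup>2
      + (L * a\<^sup>2 * \<beta>) / 2 * (norm (z' - z))\<^sup>2"
    by (simp add: field_simps)
  \<comment> \<open>With these two identities the coefficients match those in \<open>B\<close> and
    \<open>C\<close>, so the squares cancel.\<close>
  also have "L * a\<^sup>2 * \<beta> = \<mu> * (1 - a)"
    unfolding a\<gamma>[symmetric] La\<beta>[symmetric] by (simp add: power2_eq_square)
  also have "L * a\<^sup>2 * (1 - \<beta>) = \<mu> * a * (1 - a)"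
  proof -
    have "L * a\<^sup>2 * (1 - \<beta>) = (L + \<mu>) * a\<^sup>2 - \<mu> * a\<^sup>2 - a * (L * a * \<beta>)"
      by (simp add: power2_eq_square algebra_simps)
    also have "\<dots> = \<mu> - \<mu> * a\<^sup>2 - \<mu> * (1 - a)"
      by (simp only: a2 La\<beta> a\<gamma>)
    finally show ?thesis by (simp add: power2_eq_square algebra_simps)
  qed
  finally have D: "L / 2 * (norm (y' - p))\<^sup>2
      \<le> (\<mu> * a * (1 - a)) / 2 * (norm (z' - y))\<^sup>2 + \<mu> * (1 - a) / 2 * (norm (z' - z))\<^sup>2" .
  have "\<Phi> y' + \<mu> / 2 * (norm (xh - z'))\<^sup>2
      \<le> (1 - a) * g y + (1 - a) * P y + a * \<Phi> xh + \<mu> * (1 - a) / 2 * (norm (xh - z))\<^sup>2"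
    using A B C D unfolding \<Phi>_def[of y'] by (simp add: mult.commute mult.left_commute)
  then have "energy y' z' \<le> (1 - a) * energy y z"
    by (simp add: energy_def \<Phi>_def[of y] algebra_simps)
  then show ?thesis by (simp add: y'_def z'_def a_def)
qed

subsection \<open>Line search and termination\<close>

definition radius :: real where
  "radius = sqrt (2 / \<mu> * energy c c)"

lemma energy_c_le: "energy c c \<le> 2 * (\<Phi> c - \<Phi> xh)"
  using \<Phi>_growth[OF c] by (simp add: energy_def norm_minus_commute)

lemma energy_nonneg:
  assumes "y \<in> edom r"
  shows "0 \<le> energy y z"
  using \<Phi>_xh_le[OF assms] pos by (simp add: energy_def)

text \<open>Both parts of the energy are nonnegative, and by growth of \<open>\<Phi>\<close> the
  first dominates \<open>\<mu> / 2\<close> times the squared distance of \<open>y\<close> from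
  \<open>xh\<close>; so one energy bound controls \<open>y\<close> and \<open>z\<close> at
  once.\<close>

lemma energy_imp_cball:
  assumes "y \<in> edom r" "energy y z \<le> energy c c"
  shows "y \<in> cball xh radius" "z \<in> cball xh radius"
proof -
  have in_cball: "u \<in> cball xh radius" if "\<mu> / 2 * (norm (u - xh))\<^sup>2 \<le> energy y z" for u
  proof -
    have "(norm (u - xh))\<^sup>2 \<le> 2 / \<mu> * energy c c"
      using that assms(2) pos by (simp add: field_simps)
    then have "norm (u - xh) \<le> radius"
      unfolding radius_def by (rule real_le_rsqrt)
    then show ?thesis by (simp add: dist_norm norm_minus_commute)
  qed
  have "0 \<le> \<mu> / 2 * (norm (xh - z))\<^sup>2" using pos by simp
  then have "\<mu> / 2 * (norm (y - xh))\<^sup>2 \<le> energy y z"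
    using \<Phi>_growth[OF assms(1)] unfolding energy_def by linarith
  then show "y \<in> cball xh radius" by (rule in_cball)
  have "\<mu> / 2 * (norm (z - xh))\<^sup>2 \<le> energy y z"
    using \<Phi>_xh_le[OF assms(1)] by (simp add: energy_def norm_minus_commute)
  then show "z \<in> cball xh radius" by (rule in_cball)
qed

lemma query_in_cball:
  assumes "0 < L" "y \<in> edom r" "energy y z \<le> energy c c"
  shows "query y z L \<in> cball xh radius"
proof -
  note yz = energy_imp_cball[OF assms(2,3)]
  have cv: "(1 - t) *\<^sub>R u + t *\<^sub>R v \<in> cball xh radius"
    if "u \<in> cball xh radius" "v \<in> cball xh radius" "0 \<le> t" "t \<le> 1" for u v t
    using that convex_cball[of xh radius] unfolding convex_alt by blast
  show ?thesis
    unfolding query_def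
    using stepsize_bounds[OF assms(1)] gam_ratio_bounds[OF assms(1)]
    by (intro cv yz) auto
qed

lemma energy_step_le:
  assumes "0 < L" "y \<in> edom r" "agls_descent g L (query y z L) (next_y y z L)"
  shows "energy (next_y y z L) (next_z y z L) \<le> energy y z"
proof -
  have "(1 - stepsize L) * energy y z \<le> 1 * energy y z"
    using stepsize_bounds[OF assms(1)] energy_nonneg[OF assms(2)] by (intro mult_right_mono) auto
  then show ?thesis using energy_step[OF assms] by linarith
qed

text \<open>Read contrapositively, a failed test exhibits a point of the segment with a large
  modulus; this is how rejected trial values are captured in a closed set.\<close>

lemma agls_descent_of_Lip:
  assumes "\<And>\<theta>. \<theta> \<in> {0..1} \<Longrightarrow> Lip (p + \<theta> *\<^sub>R (y - p)) p + \<rho> \<le> L"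
  shows "agls_descent g L p y"
  unfolding agls_descent_def
proof (rule descent_on_segment[OF GDERIV_grad_g])
  fix \<theta> :: real assume "0 \<le> \<theta>" "\<theta> \<le> 1"
  let ?u = "p + \<theta> *\<^sub>R (y - p)"
  have "norm (grad g ?u - grad g p) \<le> (Lip ?u p + \<rho>) * norm (?u - p)"
    by (rule grad_g_diff_le)
  also have "\<dots> \<le> L * norm (?u - p)"
    using assms \<open>0 \<le> \<theta>\<close> \<open>\<theta> \<le> 1\<close> by (intro mult_right_mono) auto
  finally show "norm (grad g ?u - grad g p) \<le> L * norm (\<theta> *\<^sub>R (y - p))" by simp
qed

text \<open>
  The candidate of a rejected trial value need not lie in the ball, where \<open>M\<close> controls the
  gradient. However, the candidates depend continuously on the trial value, and those which pass
  the descent test do lie in the ball. If \<open>M < L1\<close>, then on \<open>{L1..L2}\<close> the values that pass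
  form a closed set whose complement is also closed, so that \<open>L1\<close> passes together with \<open>L2\<close>.
\<close>

lemma rejected_trial_le:
  assumes y: "y \<in> edom r" "energy y z \<le> energy c c" and L: "0 < L1" "L1 \<le> L2"
    and rejected: "\<not> agls_descent g L1 (query y z L1) (next_y y z L1)"
    and accepted: "agls_descent g L2 (query y z L2) (next_y y z L2)"
    and M: "\<forall>u\<in>cball xh radius. \<forall>w\<in>cball xh radius. Lip u w + \<rho> \<le> M"
  shows "L1 \<le> M"
proof (rule ccontr)
  assume "\<not> L1 \<le> M"
  let ?q = "query y z" and ?v = "next_y y z"
  let ?I = "{L1..L2}"
  define A where "A = {L \<in> ?I. agls_descent g L (?q L) (?v L)}"
  \<comment> \<open>The non-strict inequality makes this set closed, and compactness in the segment
    parameter carries closedness to its projection to trial values. That the projection misses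
    \<open>A\<close> is no longer automatic.\<close>
  define K where "K = {s \<in> ?I \<times> {0..1}. fst s
    \<le> Lip (?q (fst s) + snd s *\<^sub>R (?v (fst s) - ?q (fst s))) (?q (fst s)) + \<rho>}"
  have I: "?I \<subseteq> {0<..}" using L by auto
  note cont = continuous_on_subset[OF query_continuous I] continuous_on_subset[OF next_y_continuous I]
  have "closed A"
    unfolding A_def agls_descent_def
    by (intro continuous_on_closed_Collect_le continuous_intros cont
        continuous_on_compose2[OF g_continuous] continuous_on_compose2[OF grad_g_continuous]) auto
  have fst: "continuous_on (?I \<times> {0..1}) (\<lambda>s :: real \<times> real. ?q (fst s))"
    "continuous_on (?I \<times> {0..1}) (\<lambda>s :: real \<times> real. ?v (fst s))"
    by (rule continuous_on_compose2[OF cont(1) continuous_on_fst[OF continuous_on_id]]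
      continuous_on_compose2[OF cont(2) continuous_on_fst[OF continuous_on_id]]; auto)+
  have "continuous_on (?I \<times> {0..1}) (\<lambda>s :: real \<times> real.
      (?q (fst s) + snd s *\<^sub>R (?v (fst s) - ?q (fst s)), ?q (fst s)))"
    by (intro continuous_intros fst)
  from continuous_on_compose2[OF Lip_continuous this]
  have "closed K"
    unfolding K_def by (intro continuous_on_closed_Collect_le continuous_intros closed_Times) simp_all
  moreover have "K \<subseteq> ?I \<times> {0..1}" by (auto simp: K_def)
  then have "bounded K"
    by (rule bounded_subset[OF bounded_Times[OF bounded_closed_interval bounded_closed_interval]])
  ultimately have "compact K" by (simp only: compact_eq_bounded_closed)
  then have "closed (fst ` K)"
    by (intro compact_imp_closed compact_continuous_image continuous_intros)
  moreover have "?I \<subseteq> A \<union> fst ` K"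
  proof
    fix L assume LI: "L \<in> ?I"
    show "L \<in> A \<union> fst ` K"
    proof (cases "\<exists>\<theta>\<in>{0..1}. L \<le> Lip (?q L + \<theta> *\<^sub>R (?v L - ?q L)) (?q L) + \<rho>")
      case True
      then obtain \<theta> where "(L, \<theta>) \<in> K" using LI by (auto simp: K_def)
      then have "L \<in> fst ` K" by force
      then show ?thesis ..
    next
      case False
      then have "agls_descent g L (?q L) (?v L)"
        by (intro agls_descent_of_Lip) (meson le_cases)
      then show ?thesis using LI by (simp add: A_def)
    qed
  qed
  \<comment> \<open>A value that passes keeps its whole segment in the ball, so membership in
    \<open>K\<close> would give \<open>L \<le> M\<close>, against \<open>M < L1\<close>.\<close>
  moreover have "A \<inter> fst ` K = {}"
  proof (rule ccontr)
    assume "A \<inter> fst ` K \<noteq> {}"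
    then obtain L \<theta> where LA: "L \<in> A" and LK: "(L, \<theta>) \<in> K" by force
    have L0: "0 < L" and ac: "agls_descent g L (?q L) (?v L)"
      using LA I by (auto simp: A_def)
    have q: "?q L \<in> cball xh radius"
      using L0 y by (rule query_in_cball)
    have v: "?v L \<in> cball xh radius"
      using energy_imp_cball(1)[OF next_in_edom(2)[OF L0 y(1)]] energy_step_le[OF L0 y(1) ac] y(2)
      by (meson order_trans)
    have "(1 - \<theta>) *\<^sub>R ?q L + \<theta> *\<^sub>R ?v L \<in> cball xh radius"
      using q v LK convex_cball[of xh radius] unfolding convex_alt K_def by auto
    then have "?q L + \<theta> *\<^sub>R (?v L - ?q L) \<in> cball xh radius"
      by (simp add: algebra_simps)
    then have "L \<le> M"
      using M q LK by (force simp: K_def)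
    then show False using LA \<open>\<not> L1 \<le> M\<close> by (simp add: A_def)
  qed
  ultimately have "A \<inter> ?I = {} \<or> fst ` K \<inter> ?I = {}"
    using connected_closedD[of ?I A "fst ` K"] \<open>closed A\<close> by (simp add: connected_Icc)
  moreover have "L2 \<in> A \<inter> ?I" using L accepted by (simp add: A_def)
  moreover have "L1 \<in> ?I" using L by simp
  moreover from this have "L1 \<in> fst ` K"
    using rejected \<open>?I \<subseteq> A \<union> fst ` K\<close> by (auto simp: A_def)
  ultimately show False by blast
qed

text \<open>Compactness of the ball gives a finite constant even when \<open>L_dagger\<close> is
  infinite, and with it termination in every case.\<close>

lemma radius_ball_bound: "\<exists>M>0. \<forall>u\<in>cball xh radius. \<forall>w\<in>cball xh radius. Lip u w + \<rho> \<le> M"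
proof -
  let ?S = "cball xh radius \<times> cball xh radius"
  have "compact ((\<lambda>(u, w). Lip u w) ` ?S)"
    by (intro compact_continuous_image compact_Times compact_cball
        continuous_on_subset[OF Lip_continuous subset_UNIV])
  then have "bounded ((\<lambda>(u, w). Lip u w) ` ?S)" by (rule compact_imp_bounded)
  then obtain k where "0 < k" and k: "\<And>a. a \<in> (\<lambda>(u, w). Lip u w) ` ?S \<Longrightarrow> norm a \<le> k"
    unfolding bounded_pos by blast
  have "Lip u w + \<rho> \<le> k + \<rho>" if "u \<in> cball xh radius" "w \<in> cball xh radius" for u w
  proof -
    have "Lip u w \<in> (\<lambda>(u, w). Lip u w) ` ?S"
      using that by (intro image_eqI[of _ _ "(u, w)"]) simp_all
    from k[OF this] show ?thesis by simp
  qed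
  then show ?thesis using \<open>0 < k\<close> pos by (intro exI[of _ "k + \<rho>"]) simp
qed

lemma agls_step_bounds:
  assumes t: "1 \<le> t" and L0: "0 < Lh (t - 1)" and \<alpha>: "t = 1 \<or> \<alpha> (t - 1) = stepsize (Lh (t - 1))"
    and y: "y (t - 1) \<in> edom r" "energy (y (t - 1)) (z (t - 1)) \<le> energy c c"
    and \<tau>: "0 < \<tau>d" "1 < \<tau>u"
    and step: "agls_step g \<pi> \<mu> \<tau>d \<tau>u \<alpha> Lh p y z t"
    and M: "\<forall>u\<in>cball xh radius. \<forall>w\<in>cball xh radius. Lip u w + \<rho> \<le> M"
  shows "0 < Lh t" "Lh t \<le> max (\<tau>d * Lh (t - 1)) (\<tau>u * M)" "\<alpha> t = stepsize (Lh t)"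
    "y t \<in> edom r" "energy (y t) (z t) \<le> (1 - stepsize (Lh t)) * energy (y (t - 1)) (z (t - 1))"
    "p t \<in> cball xh radius"
proof -
  let ?y = "y (t - 1)" and ?z = "z (t - 1)" and ?L = "\<tau>d * Lh (t - 1)"
  note trial_iff = agls_trial_iff[OF _ L0 \<alpha>]
  obtain k where k: "Lh t = ?L * \<tau>u ^ k"
    and trial: "agls_trial g \<pi> \<mu> t (\<alpha> (t - 1)) (Lh (t - 1)) ?y ?z (Lh t) (\<alpha> t) (p t) (z t) (y t)"
    and descent: "agls_descent g (Lh t) (p t) (y t)"
    and first: "\<And>j a q w v. j < k \<Longrightarrow>
      agls_trial g \<pi> \<mu> t (\<alpha> (t - 1)) (Lh (t - 1)) ?y ?z (?L * \<tau>u ^ j) a q w v \<Longrightarrow>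
      \<not> agls_descent g (?L * \<tau>u ^ j) q v"
    using step unfolding agls_step_def Let_def by blast
  have trial_pos: "0 < ?L * \<tau>u ^ j" for j using L0 \<tau> by simp
  show L: "0 < Lh t" unfolding k by (rule trial_pos)
  from trial have eq: "\<alpha> t = stepsize (Lh t)" "p t = query ?y ?z (Lh t)"
    "z t = next_z ?y ?z (Lh t)" "y t = next_y ?y ?z (Lh t)"
    by (simp_all only: trial_iff[OF L] simp_thms)
  note accepted = descent[unfolded eq(2,4)]
  show "\<alpha> t = stepsize (Lh t)" by (rule eq)
  show "y t \<in> edom r" unfolding eq using L y(1) by (rule next_in_edom)
  show "energy (y t) (z t) \<le> (1 - stepsize (Lh t)) * energy ?y ?z"
    unfolding eq using L y(1) accepted by (rule energy_step)
  show "p t \<in> cball xh radius" unfolding eq using L y by (rule query_in_cball)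
  show "Lh t \<le> max ?L (\<tau>u * M)"
  proof (cases k)
    case 0
    then show ?thesis by (simp add: k)
  next
    \<comment> \<open>The last rejected trial value is \<open>Lh t / \<tau>u\<close>; bounding this
      one is enough.\<close>
    case (Suc j)
    let ?L1 = "?L * \<tau>u ^ j"
    have Lt: "Lh t = \<tau>u * ?L1" by (simp add: k Suc)
    have "\<not> agls_descent g ?L1 (query ?y ?z ?L1) (next_y ?y ?z ?L1)"
    proof (rule first)
      show "agls_trial g \<pi> \<mu> t (\<alpha> (t - 1)) (Lh (t - 1)) ?y ?z ?L1 (stepsize ?L1)
          (query ?y ?z ?L1) (next_z ?y ?z ?L1) (next_y ?y ?z ?L1)"
        by (simp only: trial_iff[OF trial_pos] simp_thms)
    qed (simp add: Suc)
    moreover have "?L1 \<le> Lh t"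
      unfolding Lt using trial_pos[of j] \<tau> by (simp only: mult_le_cancel_right1) simp
    ultimately have "?L1 \<le> M"
      using rejected_trial_le[OF y trial_pos _ _ accepted M] by blast
    then have "\<tau>u * ?L1 \<le> \<tau>u * M" using \<tau> by (intro mult_left_mono) auto
    then show ?thesis using Lt by (simp only: le_max_iff_disj simp_thms)
  qed
qed

text \<open>The bound on \<open>\<tau>d * Lh t\<close> is kept apart because
  \<open>Lh 0 = L0\<close> may exceed the bound that later values satisfy; it is what an iteration
  without rejection passes on. Of the two energy bounds, the product gives the decrease at the stop
  and the plain one confinement to the ball.\<close>

lemma agls_run_invariant:
  assumes run: "agls_run g \<pi> \<mu> L0 \<tau>d \<tau>u c \<alpha> Lh p y z out"
    and inputs: "0 < L0" "0 < \<tau>d" "\<tau>d < 1" "1 < \<tau>u"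
    and M: "\<forall>u\<in>cball xh radius. \<forall>w\<in>cball xh radius. Lip u w + \<rho> \<le> M"
    and t: "t = 0 \<or> agls_performed \<mu> Lh t"
  shows "0 < Lh t \<and> y t \<in> edom r \<and> p t \<in> cball xh radius \<and>
    energy (y t) (z t) \<le> (\<Prod>i = 1..t. 1 - stepsize (Lh i)) * energy c c \<and>
    energy (y t) (z t) \<le> energy c c \<and> \<tau>d * Lh t \<le> max (\<tau>d * L0) (\<tau>u * M) \<and>
    (t \<noteq> 0 \<longrightarrow> \<alpha> t = stepsize (Lh t) \<and> Lh t \<le> max (\<tau>d * L0) (\<tau>u * M))"
  using t
proof (induction t)
  case 0
  have "energy c c \<le> energy c c" by simp
  from energy_imp_cball[OF c this] show ?case
    using run inputs c by (simp add: agls_run_def)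
next
  case (Suc t)
  have "t = 0 \<or> agls_performed \<mu> Lh t"
    using Suc.prems agls_performed_Suc[of t \<mu> Lh] by (cases "t = 0") auto
  from Suc.IH[OF this] have IH: "0 < Lh t" "y t \<in> edom r"
    "energy (y t) (z t) \<le> (\<Prod>i = 1..t. 1 - stepsize (Lh i)) * energy c c"
    "energy (y t) (z t) \<le> energy c c" "\<tau>d * Lh t \<le> max (\<tau>d * L0) (\<tau>u * M)"
    "Suc t = 1 \<or> \<alpha> t = stepsize (Lh t)"
    by auto
  have perf: "agls_step g \<pi> \<mu> \<tau>d \<tau>u \<alpha> Lh p y z (Suc t)"
    using run Suc.prems by (simp add: agls_run_def)
  have one: "1 \<le> Suc t" by simp
  note step = agls_step_bounds[where t = "Suc t", unfolded diff_Suc_1,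
      OF one IH(1) IH(6) IH(2,4) inputs(2,4) perf M]
  let ?s = "stepsize (Lh (Suc t))"
  have s: "0 < ?s" "?s < 1" using stepsize_bounds[OF step(1)] by simp_all
  have "energy (y (Suc t)) (z (Suc t)) \<le> (1 - ?s) * ((\<Prod>i = 1..t. 1 - stepsize (Lh i)) * energy c c)"
    by (rule order_trans[OF step(5) mult_left_mono[OF IH(3)]]) (use s in simp)
  then have prod: "energy (y (Suc t)) (z (Suc t))
      \<le> (\<Prod>i = 1..Suc t. 1 - stepsize (Lh i)) * energy c c"
    by (simp add: prod.nat_ivl_Suc' mult.assoc mult.left_commute)
  have "(1 - ?s) * energy (y t) (z t) \<le> 1 * energy (y t) (z t)"
    using s energy_nonneg[OF IH(2)] by (intro mult_right_mono) auto
  then have le: "energy (y (Suc t)) (z (Suc t)) \<le> energy c c"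
    using step(5) IH(4) by linarith
  have Lh: "Lh (Suc t) \<le> max (\<tau>d * L0) (\<tau>u * M)"
    using step(2) IH(5) by linarith
  have "\<tau>d * Lh (Suc t) \<le> Lh (Suc t)"
    using inputs step(1) by simp
  with Lh have "\<tau>d * Lh (Suc t) \<le> max (\<tau>d * L0) (\<tau>u * M)" by linarith
  with step(1,3,4,6) prod le Lh show ?case by blast
qed

lemma agls_run_stops:
  assumes run: "agls_run g \<pi> \<mu> L0 \<tau>d \<tau>u c \<alpha> Lh p y z out"
    and inputs: "0 < L0" "0 < \<tau>d" "\<tau>d < 1" "1 < \<tau>u"
  shows "finite {t. agls_performed \<mu> Lh t}" "out \<in> edom r" "\<Phi> out \<le> \<Phi> c"
proof -
  obtain M where "0 < M"
    and M: "\<forall>u\<in>cball xh radius. \<forall>w\<in>cball xh radius. Lip u w + \<rho> \<le> M"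
    using radius_ball_bound by blast
  note inv = agls_run_invariant[OF run inputs M]
  \<comment> \<open>The factor 2 only fits the shape of the count, which bounds \<open>Lh\<close> by
    \<open>X / 2\<close>; any finite bound yields termination.\<close>
  have "0 < Lh t \<and> Lh t \<le> (2 * max (\<tau>d * L0) (\<tau>u * M)) / 2" if "agls_performed \<mu> Lh t" for t
    using inv[of t] that by (simp add: agls_performed_def)
  moreover have "0 < 2 * max (\<tau>d * L0) (\<tau>u * M)" using inputs by (simp add: less_max_iff_disj)
  ultimately show fin: "finite {t. agls_performed \<mu> Lh t}"
    using agls_iteration_count(1)[OF pos(2)] by blast
  obtain t where t: "agls_performed \<mu> Lh t" "agls_stop \<mu> Lh t"
    using fin by (rule agls_stop_exists)
  have out: "out = y t" using run t by (simp add: agls_run_def)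
  have y: "y t \<in> edom r" using inv[of t] t by simp
  then show "out \<in> edom r" by (simp add: out)
  have "\<Phi> out - \<Phi> xh \<le> energy (y t) (z t)"
    using pos by (simp add: energy_def out)
  also have "\<dots> \<le> (\<Prod>i = 1..t. 1 - stepsize (Lh i)) * energy c c"
    using inv[of t] t by simp
  \<comment> \<open>The \<open>1 / 4\<close> of the early stop outweighs the factor 2 in the initial
    energy.\<close>
  also have "\<dots> \<le> 1 / 4 * energy c c"
    using t(2) energy_nonneg[OF c]
    unfolding agls_stop_def stepsize_def by (rule mult_right_mono)
  also have "\<dots> \<le> 1 / 4 * (2 * (\<Phi> c - \<Phi> xh))"
    using energy_c_le by simp
  also have "\<dots> \<le> \<Phi> c - \<Phi> xh"
    using \<Phi>_xh_le[OF c] by simp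
  finally show "\<Phi> out \<le> \<Phi> c" by simp
qed

section \<open>Return to the composite objective\<close>

lemma le_\<Phi>: "F u + R u \<le> \<Phi> u"
proof -
  have "0 \<le> \<rho> / 2 * (norm (u - c))\<^sup>2" "0 \<le> \<mu> / 2 * (norm (u - c))\<^sup>2"
    using pos by simp_all
  then show ?thesis unfolding \<Phi>_def P_def g_def by linarith
qed

text \<open>The quadratic terms vanish at \<open>c\<close> and are nonnegative elsewhere. This
  brings both the output of AGLS and the proximal point into the sublevel set.\<close>

lemma composite_le:
  assumes "u \<in> edom r" "\<Phi> u \<le> \<Phi> c"
  shows "composite F r u \<le> composite F r c"
proof -
  have "F u + R u \<le> \<Phi> c" using le_\<Phi> assms(2) by (rule order_trans)
  then show ?thesis
    using assms(1) c by (simp add: composite_def r_eq \<Phi>_def P_def g_def)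
qed

lemma radius_le:
  assumes "ereal l \<le> composite F r xh" "composite F r c \<le> ereal a"
  shows "radius \<le> sqrt (8 / \<mu> * (a - l))"
proof -
  have "F c + R c \<le> a" using assms(2) c by (simp add: composite_def r_eq)
  then have "\<Phi> c \<le> a" by (simp add: \<Phi>_def P_def g_def)
  moreover have "l \<le> F xh + R xh"
    using assms(1) xh_in_edom by (simp add: composite_def r_eq)
  then have "l \<le> \<Phi> xh"
    using le_\<Phi> by (rule order_trans)
  ultimately have "2 * (\<Phi> c - \<Phi> xh) \<le> 2 * (a - l)"
    by (intro mult_left_mono diff_mono) simp_all
  with energy_c_le have "energy c c \<le> 2 * (a - l)" by (rule order_trans)
  \<comment> \<open>Doubling the bound produces the constant 8 in \<open>D\<close>; that
    \<open>a - l\<close> is nonnegative comes from the energy.\<close>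
  then have "energy c c \<le> 4 * (a - l)"
    using energy_nonneg[OF c, of c] by linarith
  then have "2 / \<mu> * energy c c \<le> 2 / \<mu> * (4 * (a - l))"
    using pos by (intro mult_left_mono) auto
  then show ?thesis unfolding radius_def by simp
qed

end

section \<open>The outer iteration\<close>

text \<open>The scheme puts only \<open>x0\<close> in the domain. For a later centre this follows
  from the sublevel bound, so that well-posedness of each call and descent of the outer iterates go
  through one induction.\<close>

lemma agls_sipp_subproblem:
  fixes fe :: "'a::euclidean_space \<Rightarrow> real" and r :: "'a \<Rightarrow> ereal"
  assumes r: "proper_fun r" "convex_efun r" "lsc_efun r" "\<And>u. ereal b \<le> r u"
    and F: "cont_diff fe" "weakly_convex \<rho>bar fe"
      "\<And>u w. norm (grad fe u - grad fe w) \<le> Lip u w * norm (u - w)"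
      "continuous_on UNIV (\<lambda>(u, w). Lip u w)"
    and rho: "0 < \<rho>bar" "\<rho>bar < \<rho>hat"
    and inputs: "0 < L0" "0 < \<tau>d" "\<tau>d < 1" "1 < \<tau>u"
    and run: "agls_sipp fe r \<rho>bar \<rho>hat L0 \<tau>d \<tau>u K x0 x xh \<alpha> Lh p y z"
    and k: "k \<in> {1..K}" and prev: "composite fe r (x (k - 1)) \<le> composite fe r x0"
  shows "agls_subproblem r fe Lip \<rho>bar (\<rho>hat - \<rho>bar) b (x (k - 1)) (xh k)"
    and "agls_run (agls_subproblem.g fe \<rho>bar (x (k - 1)))
      (agls_subproblem.\<pi> r (\<rho>hat - \<rho>bar) (x (k - 1)))
      (\<rho>hat - \<rho>bar) L0 \<tau>d \<tau>u (x (k - 1)) (\<alpha> k) (Lh k) (p k) (y k) (z k) (x k)"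
proof -
  have "x (k - 1) \<in> edom r"
  proof -
    have "composite fe r x0 < \<infinity>"
      using run by (simp add: agls_sipp_def composite_def edom_def)
    with prev have "composite fe r (x (k - 1)) < \<infinity>" by (rule le_less_trans)
    then show ?thesis by (simp add: composite_def edom_def)
  qed
  moreover have "is_arg_min (\<lambda>u. composite fe r u +
      ereal ((\<rho>bar + (\<rho>hat - \<rho>bar)) / 2 * (norm (u - x (k - 1)))\<^sup>2)) (\<lambda>_. True) (xh k)"
    using run k by (simp add: agls_sipp_def)
  ultimately show sub: "agls_subproblem r fe Lip \<rho>bar (\<rho>hat - \<rho>bar) b (x (k - 1)) (xh k)"
    using r F rho by unfold_locales simp_all
  show "agls_run (agls_subproblem.g fe \<rho>bar (x (k - 1)))
      (agls_subproblem.\<pi> r (\<rho>hat - \<rho>bar) (x (k - 1)))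
      (\<rho>hat - \<rho>bar) L0 \<tau>d \<tau>u (x (k - 1)) (\<alpha> k) (Lh k) (p k) (y k) (z k) (x k)"
    unfolding agls_subproblem.g_def[OF sub] agls_subproblem.\<pi>_def[OF sub]
    using run k by (simp add: agls_sipp_def)
qed

theorem theorem6p3:
  fixes f :: "'a::euclidean_space \<Rightarrow> real" and r :: "'a \<Rightarrow> ereal"
    and fe :: "real \<Rightarrow> 'a \<Rightarrow> real" and \<R> :: "real \<Rightarrow> real"
    and \<L> :: "real \<Rightarrow> 'a \<Rightarrow> 'a \<Rightarrow> real" and B L :: "'a \<Rightarrow> 'a \<Rightarrow> real"
    and \<eta> \<rho>f \<rho>bar \<rho>hat l L0 \<tau>d \<tau>u D :: real and K :: nat and x0 :: 'a
    and x xh :: "nat \<Rightarrow> 'a" and \<alpha> Lh :: "nat \<Rightarrow> nat \<Rightarrow> real" and p y z :: "nat \<Rightarrow> nat \<Rightarrow> 'a"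
    and S0 :: "'a set" and Ld :: ereal
  assumes f: "weakly_convex \<rho>f f"
    and r: "proper_fun r" "convex_efun r" "lsc_efun r"
    and fe: "smooth_approx f fe \<rho>bar \<R> \<L>"
    and rho: "0 < \<rho>bar" "\<rho>bar < \<rho>hat"
    and r_bdd: "\<exists>c. \<forall>u. ereal c \<le> r u"
    and fe_bdd: "\<forall>\<epsilon>>0. \<exists>c. \<forall>u. c \<le> fe \<epsilon> u"
    and \<L>: "\<forall>\<epsilon>>0. \<forall>u v. \<L> \<epsilon> u v = B u v + L u v / \<epsilon>"
    and B: "\<forall>u v. 0 \<le> B u v \<and> B u v = B v u" "continuous_on UNIV (\<lambda>(u, v). B u v)"
    and L: "\<forall>u v. 0 \<le> L u v \<and> L u v = L v u" "continuous_on UNIV (\<lambda>(u, v). L u v)"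
    and eta: "0 < \<eta>"
    and l: "\<forall>u. ereal l \<le> composite (fe \<eta>) r u"
    and inputs: "0 < L0" "0 < \<tau>d" "\<tau>d < 1" "1 < \<tau>u"
    and run: "agls_sipp (fe \<eta>) r \<rho>bar \<rho>hat L0 \<tau>d \<tau>u K x0 x xh \<alpha> Lh p y z"
    and S0_def: "S0 = sublevel (composite (fe \<eta>) r) x0"
    and D_def: "D = sqrt (8 / (\<rho>hat - \<rho>bar) * (real_of_ereal (composite f r x0) - l))"
    and Ld_def: "Ld = L_dagger (\<L> \<eta>) \<rho>bar (enlarge D S0)"
  shows "(\<forall>k\<in>{0..K}. x k \<in> S0) \<and> (\<forall>k\<in>{1..K}. xh k \<in> S0) \<and>
    (\<forall>k\<in>{1..K}. \<forall>t. t = 0 \<or> agls_performed (\<rho>hat - \<rho>bar) (Lh k) t \<longrightarrow>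
       p k t \<in> enlarge D S0 \<and> y k t \<in> enlarge D S0 \<and> z k t \<in> enlarge D S0) \<and>
    finite (agls_iterations (\<rho>hat - \<rho>bar) K Lh) \<and>
    (Ld \<noteq> \<infinity> \<and> 2 * \<tau>d * L0 \<le> \<tau>u * real_of_ereal Ld \<longrightarrow>
       int (card (agls_iterations (\<rho>hat - \<rho>bar) K Lh))
         \<le> \<lceil>ln 4 * sqrt ((\<tau>u * real_of_ereal Ld + \<rho>hat - \<rho>bar) / (\<rho>hat - \<rho>bar)) * real K\<rceil>)"
proof -
  let ?F = "fe \<eta>" and ?Lip = "\<L> \<eta>" and ?\<mu> = "\<rho>hat - \<rho>bar"
  let ?\<phi> = "composite ?F r"
  obtain b where b: "\<And>u. ereal b \<le> r u" using r_bdd by blast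
  have F: "cont_diff ?F" "weakly_convex \<rho>bar ?F"
      "\<And>u w. norm (grad ?F u - grad ?F w) \<le> ?Lip u w * norm (u - w)"
    and F_le_f: "\<And>u. ?F u \<le> f u"
    using fe eta unfolding smooth_approx_def by blast+
  have "(\<lambda>(u, w). ?Lip u w) = (\<lambda>s. (\<lambda>(u, w). B u w) s + (\<lambda>(u, w). L u w) s / \<eta>)"
    using \<L> eta by auto
  moreover have "continuous_on UNIV (\<lambda>s. (\<lambda>(u, w). B u w) s + (\<lambda>(u, w). L u w) s / \<eta>)"
    using eta by (intro continuous_on_add continuous_on_divide B(2) L(2) continuous_on_const) simp
  ultimately have Lip_cont: "continuous_on UNIV (\<lambda>(u, w). ?Lip u w)" by (simp only:)
  have x0: "x0 \<in> edom r" "x 0 = x0" using run by (simp_all add: agls_sipp_def)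
  note subproblem = agls_sipp_subproblem[OF r b F Lip_cont rho inputs run]
  have S0_iff: "u \<in> S0 \<longleftrightarrow> ?\<phi> u \<le> ?\<phi> x0" for u
    by (simp add: S0_def sublevel_def)

  have x_le: "?\<phi> (x k) \<le> ?\<phi> x0" if "k \<le> K" for k
    using that
  proof (induction k)
    case (Suc k)
    have k: "Suc k \<in> {1..K}" using Suc.prems by simp
    have prev: "?\<phi> (x (Suc k - 1)) \<le> ?\<phi> x0" using Suc by simp
    interpret agls_subproblem r ?F ?Lip \<rho>bar ?\<mu> b "x (Suc k - 1)" "xh (Suc k)"
      using k prev by (rule subproblem)
    note stops = agls_run_stops[OF subproblem(2)[OF k prev] inputs]
    show ?case
      using composite_le[OF stops(2,3)] prev by (rule order_trans)
  qed (simp add: x0)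
  have prev: "?\<phi> (x (k - 1)) \<le> ?\<phi> x0" if "k \<in> {1..K}" for k
    using that by (intro x_le) auto
  note sub = subproblem(1)[OF _ prev] and sub_run = subproblem(2)[OF _ prev]

  have xh_le: "?\<phi> (xh k) \<le> ?\<phi> x0" if k: "k \<in> {1..K}" for k
  proof -
    interpret agls_subproblem r ?F ?Lip \<rho>bar ?\<mu> b "x (k - 1)" "xh k"
      using k k by (rule sub)
    show ?thesis
      using composite_le[OF xh_in_edom \<Phi>_xh_le[OF c]] prev[OF k] by (rule order_trans)
  qed

  \<comment> \<open>\<open>D\<close> is stated with \<open>f\<close>, the sublevel set with
    \<open>fe \<eta>\<close>; the bound \<open>fe \<eta> \<le> f\<close> bridges them.
    \<open>real_of_ereal\<close> loses nothing here, as \<open>x0\<close> is in the domain.\<close>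
  have \<phi>_f: "?\<phi> x0 \<le> ereal (real_of_ereal (composite f r x0))"
  proof -
    obtain s where "r x0 = ereal s"
      using x0(1) b[of x0] by (cases "r x0") (auto simp: edom_def)
    then show ?thesis using F_le_f[of x0] by (simp add: composite_def)
  qed
  have ball: "cball (xh k) (agls_subproblem.radius r ?F \<rho>bar ?\<mu> (x (k - 1)) (xh k)) \<subseteq> enlarge D S0"
    if k: "k \<in> {1..K}" for k
  proof
    interpret agls_subproblem r ?F ?Lip \<rho>bar ?\<mu> b "x (k - 1)" "xh k"
      using k k by (rule sub)
    have "radius \<le> D"
      unfolding D_def using l order_trans[OF prev[OF k] \<phi>_f] by (intro radius_le) auto
    moreover fix u assume "u \<in> cball (xh k) radius"
    moreover have "infdist u S0 \<le> dist u (xh k)"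
      using xh_le[OF k] by (intro infdist_le) (simp add: S0_iff)
    ultimately show "u \<in> enlarge D S0"
      by (simp add: enlarge_def dist_commute)
  qed

  have iterates: "p k t \<in> enlarge D S0 \<and> y k t \<in> enlarge D S0 \<and> z k t \<in> enlarge D S0"
    if k: "k \<in> {1..K}" and t: "t = 0 \<or> agls_performed ?\<mu> (Lh k) t" for k t
  proof -
    interpret agls_subproblem r ?F ?Lip \<rho>bar ?\<mu> b "x (k - 1)" "xh k"
      using k k by (rule sub)
    obtain M where "\<forall>u\<in>cball (xh k) radius. \<forall>w\<in>cball (xh k) radius. ?Lip u w + \<rho>bar \<le> M"
      using radius_ball_bound by blast
    note inv = agls_run_invariant[OF sub_run[OF k k] inputs this t]
    then have "p k t \<in> cball (xh k) radius" "y k t \<in> cball (xh k) radius" "z k t \<in> cball (xh k) radius"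
      using energy_imp_cball[of "y k t" "z k t"] by blast+
    then show ?thesis using ball[OF k] by blast
  qed

  have iterations: "agls_iterations ?\<mu> K Lh = (SIGMA k:{1..K}. {t. agls_performed ?\<mu> (Lh k) t})"
    by (auto simp: agls_iterations_def)
  have fin: "finite {t. agls_performed ?\<mu> (Lh k) t}" if k: "k \<in> {1..K}" for k
    using agls_subproblem.agls_run_stops(1)[OF sub[OF k k] sub_run[OF k k] inputs] .

  have count: "int (card (agls_iterations ?\<mu> K Lh))
      \<le> \<lceil>ln 4 * sqrt ((\<tau>u * real_of_ereal Ld + \<rho>hat - \<rho>bar) / ?\<mu>) * real K\<rceil>"
    if Ld: "Ld \<noteq> \<infinity>" and small: "2 * \<tau>d * L0 \<le> \<tau>u * real_of_ereal Ld"
  proof -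
    let ?X = "\<tau>u * real_of_ereal Ld"
    have Ld_ge: "2 * (?Lip u w + \<rho>bar) \<le> real_of_ereal Ld"
      if "u \<in> enlarge D S0" "w \<in> enlarge D S0" for u w
    proof -
      have "ereal (2 * ?Lip u w + 2 * \<rho>bar) \<le> Ld"
        unfolding Ld_def L_dagger_def using that by (intro SUP_upper2[of "(u, w)"]) auto
      then show ?thesis using Ld by (cases Ld) auto
    qed
    have "0 < 2 * \<tau>d * L0" using inputs by simp
    then have X: "0 < ?X" using small by (rule less_le_trans)
    have card_k: "real (card {t. agls_performed ?\<mu> (Lh k) t}) \<le> ln 4 * sqrt ((?X + ?\<mu>) / ?\<mu>)"
      if k: "k \<in> {1..K}" for k
    proof (rule agls_iteration_count(2))
      interpret agls_subproblem r ?F ?Lip \<rho>bar ?\<mu> b "x (k - 1)" "xh k"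
        using k k by (rule sub)
      have M: "\<forall>u\<in>cball (xh k) radius. \<forall>w\<in>cball (xh k) radius. ?Lip u w + \<rho>bar \<le> real_of_ereal Ld / 2"
      proof (intro ballI)
        fix u w assume "u \<in> cball (xh k) radius" "w \<in> cball (xh k) radius"
        then have "2 * (?Lip u w + \<rho>bar) \<le> real_of_ereal Ld"
          using ball[OF k] by (intro Ld_ge) blast+
        then show "?Lip u w + \<rho>bar \<le> real_of_ereal Ld / 2" by simp
      qed
      fix t assume t: "agls_performed ?\<mu> (Lh k) t"
      have "t \<noteq> 0" using t by (auto simp: agls_performed_def)
      with agls_run_invariant[OF sub_run[OF k k] inputs M disjI2[OF t]]
      have "0 < Lh k t" "Lh k t \<le> max (\<tau>d * L0) (\<tau>u * (real_of_ereal Ld / 2))" by blast+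
      \<comment> \<open>Here the factor 2 in \<open>L_dagger\<close> is used: the modulus bound is
        \<open>real_of_ereal Ld / 2\<close>. The other term of the maximum, which stems from trial
        values accepted without rejection, is covered by \<open>small\<close>.\<close>
      moreover have "max (\<tau>d * L0) (\<tau>u * (real_of_ereal Ld / 2)) \<le> ?X / 2"
        using small by simp
      ultimately show "0 < Lh k t \<and> Lh k t \<le> ?X / 2" by linarith
    qed (use rho X in auto)
    have "card (agls_iterations ?\<mu> K Lh) = (\<Sum>k\<in>{1..K}. card {t. agls_performed ?\<mu> (Lh k) t})"
      unfolding iterations using fin by (intro card_SigmaI) auto
    then have "real (card (agls_iterations ?\<mu> K Lh))
        = (\<Sum>k\<in>{1..K}. real (card {t. agls_performed ?\<mu> (Lh k) t}))" by simp
    also have "\<dots> \<le> (\<Sum>k\<in>{1..K}. ln 4 * sqrt ((?X + ?\<mu>) / ?\<mu>))"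
      by (intro sum_mono card_k)
    also have "\<dots> = ln 4 * sqrt ((\<tau>u * real_of_ereal Ld + \<rho>hat - \<rho>bar) / ?\<mu>) * real K"
      by (simp add: add_diff_eq)
    finally show ?thesis by (simp add: le_ceiling_iff)
  qed
  have "finite (agls_iterations ?\<mu> K Lh)"
    unfolding iterations using fin by (intro finite_SigmaI) auto
  moreover have "\<forall>k\<in>{0..K}. x k \<in> S0" "\<forall>k\<in>{1..K}. xh k \<in> S0"
    using x_le xh_le by (simp_all add: S0_iff)
  ultimately show ?thesis
    using iterates count by blast
qed

end
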